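(* Let $g$ be a sufficiently large natural number, let $b\in\{2,3,\dots,g-1\}$ be fixed, and let $X$ be a power of $g$. For real $Y<Z$ let $[Y,Z]^{\ast}$ denote the set of natural numbers $n$ with $Y<n\le Z$ whose base-$g$ expansion uses only digits from $\{0,1,\dots,g-1\}\setminus\{b\}$. Let $$\lambda=1-\frac{\log(\log g+1)}{\log(g-1)},$$ and let $H>0$ satisfy $|[1,H]^{\ast}|=\left(X/(\log X)^{3}\right)^{1/(2\lambda)}$. Let $\eta>0$ be a sufficiently small fixed constant and put $P=X^{1/4-\eta}$, $Q=P^{2}$. Then, as $X\to\infty$, $$\sum_{n\in[X,X+H]^{\ast}} d_2(n)=\sum_{q\le P}\int_{|\beta|<\frac{1}{qQ}}\int_X^{X+H} p^{\ast}_{2,q}(x)\,e(\beta x)\sum_{n\in[X,X+H]^{\ast}} c_q(n)\,e(-n\beta)\,dx\,d\beta+O\!\left(|[X,X+H]^{\ast}|(\log X)^{5/2}\right),$$ where $$p^{\ast}_{2,q}(x)=\frac{1}{q}\left(\log x+2\gamma-2\log q\right),\qquad c_q(n)=\sum_{\substack{1\le a\le q\\ (a,q)=1}} e\!\left(\frac{an}{q}\right).$$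
   Context: $d_2(n)$ denotes the number of positive divisors of $n$; $e(x)=e^{2\pi i x}$; $\gamma$ is the Euler–Mascheroni constant; $|A|$ denotes the cardinality of a finite set $A$. *)

theory Defs
  imports "HOL-Analysis.Analysis"
begin

text \<open>The digits in the base-\<open>g\<close> expansion of \<open>n\<close>, without leading zeros: position \<open>i\<close> occurs
  in the expansion iff \<open>g ^ i \<le> n\<close>.\<close>

definition base_digits :: "nat \<Rightarrow> nat \<Rightarrow> nat set" where
  "base_digits g n = {(n div g ^ i) mod g | i. g ^ i \<le> n}"

definition missing_digit_interval :: "nat \<Rightarrow> nat \<Rightarrow> real \<Rightarrow> real \<Rightarrow> nat set" where
  "missing_digit_interval g b Y Z =
     {n. Y < real n \<and> real n \<le> Z \<and> base_digits g n \<subseteq> {0..<g} - {b}}"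

definition d2 :: "nat \<Rightarrow> nat" where
  "d2 n = card {d. d dvd n}"

definition e :: "real \<Rightarrow> complex" where
  "e x = exp (2 * of_real pi * \<i> * of_real x)"

definition ramanujan_sum :: "nat \<Rightarrow> nat \<Rightarrow> complex" where
  "ramanujan_sum q n = (\<Sum>a | 1 \<le> a \<and> a \<le> q \<and> coprime a q. e (real a * real n / real q))"

definition p2_star :: "nat \<Rightarrow> real \<Rightarrow> real" where
  "p2_star q x = 1 / real q * (ln x + 2 * euler_mascheroni - 2 * ln (real q))"

text \<open>The exponent governing the length \<open>H\<close> of the short interval. The prescribed size
  \<open>(X / (ln X) ^ 3) powr (1 / (2 * lambda_exp g))\<close> of \<open>missing_digit_interval g b 1 H\<close> is in general
  not an integer, so the equality of the two has to be read up to rounding, that is, up to an error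
  less than \<open>1\<close>.\<close>

definition lambda_exp :: "nat \<Rightarrow> real" where
  "lambda_exp g = 1 - ln (ln (real g) + 1) / ln (real g - 1)"

definition major_arc_term :: "nat set \<Rightarrow> real \<Rightarrow> real \<Rightarrow> real \<Rightarrow> real \<Rightarrow> complex" where
  "major_arc_term A X H P Q =
     (\<Sum>q | 1 \<le> q \<and> real q \<le> P.
        integral {\<beta>. \<bar>\<beta>\<bar> < 1 / (real q * Q)} (\<lambda>\<beta>.
          integral {X..X + H} (\<lambda>x.
            of_real (p2_star q x) * e (\<beta> * x) *
              (\<Sum>n\<in>A. ramanujan_sum q n * e (- (real n * \<beta>))))))"

end

theory Submission
  imports Defs "HOL-Real_Asymp.Real_Asymp"
begin

text \<open>
  The error term exceeds both sides: the divisor sum and the major arc term are separately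
  \<open>O(|A| (ln X)\<^sup>5\<^sup>/\<^sup>2)\<close>.  Let \<open>g\<^sup>J\<^sup>-\<^sup>1 \<le> H < g\<^sup>J\<close>, let \<open>F\<^sub>i\<close> be the exponential sum over the numbers
  below \<open>g\<^sup>i\<close> without the digit \<open>b\<close>, and put \<open>L = ln g + 1\<close>.  As \<open>F\<^sub>i\<close> is a product over the digit
  positions, its values at points of distinct cells of length \<open>g\<^sup>-\<^sup>m\<close> add up to at most
  \<open>(g - 1)\<^sup>i\<^sup>-\<^sup>m (g L)\<^sup>m\<close> if \<open>m \<le> i\<close>, and to at most \<open>g\<^sup>m L\<^sup>i\<close> otherwise.  Applied to the reduced fractions
  \<open>a/q\<close> with \<open>g\<^sup>s \<le> q < g\<^sup>s\<^sup>+\<^sup>1\<close>, possibly shifted a little, this gives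
  \<open>\<Sum>\<^sub>q 1/q \<Sum>\<^sub>a |F\<^sub>i(a/q - \<beta>\<^sub>q)| \<lless> (g - 1)\<^sup>i + R L\<^sup>i\<close> for denominators up to \<open>R\<close>.

  The divisor sum is at most twice the number of pairs \<open>d | n\<close> with \<open>d \<le> \<surd>n\<close>; detecting \<open>d | n\<close> by
  additive characters reduces it to this estimate with \<open>R\<close> of order \<open>\<surd>X\<close>, at the cost of one factor
  \<open>ln X\<close>.  By the choice of \<open>H\<close>, \<open>\<surd>X L\<^sup>J \<lless> |A| (ln X)\<^sup>3\<^sup>/\<^sup>2\<close>.  On the major arcs the inner integral is
  \<open>O(1/q ln X min(H, 1/|\<beta>|))\<close>, which costs \<open>(ln X)\<^sup>2\<close> after integration over \<open>\<beta>\<close>, and the estimate is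
  applied with \<open>R\<close> of order \<open>P\<close>, where the second term is negligible.
\<close>

section \<open>Digit sums and exponential sums over missing-digit numbers\<close>

lemma e_add: "e (x + y) = e x * e y"
  unfolding e_def by (simp add: ring_distribs exp_add)

lemma norm_e [simp]: "norm (e x) = 1"
proof -
  have "e x = cis (2 * pi * x)"
    unfolding e_def cis_conv_exp by (simp add: algebra_simps)
  thus ?thesis by simp
qed

lemma e_of_int [simp]: "e (of_int k) = 1"
proof -
  have "e (of_int k) = cis (2 * pi * of_int k)"
    unfolding e_def cis_conv_exp by (simp add: algebra_simps)
  thus ?thesis by (simp add: cis_multiple_2pi)
qed

lemma e_0 [simp]: "e 0 = 1"
  by (simp add: e_def)

lemma e_of_nat [simp]: "e (of_nat k) = 1"
  using e_of_int[of "int k"] by simp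

lemma e_add_int [simp]: "e (x + of_int k) = e x"
  by (simp add: e_add)

lemma e_power: "e x ^ n = e (real n * x)"
  unfolding e_def by (simp add: exp_of_nat_mult [symmetric] algebra_simps)

lemma norm_one_minus_e: "norm (1 - e x) = 2 * \<bar>sin (pi * x)\<bar>"
proof -
  have "e x = cis (2 * pi * x)"
    unfolding e_def cis_conv_exp by (simp add: algebra_simps)
  moreover have "norm (1 - cis (2 * pi * x)) ^ 2 = (2 * \<bar>sin (pi * x)\<bar>) ^ 2"
  proof -
    have "cos (2 * pi * x) = 1 - 2 * sin (pi * x) ^ 2"
      using cos_double_sin[of "pi * x"] by (simp add: algebra_simps)
    moreover have "norm (1 - cis (2 * pi * x)) ^ 2 =
        1 - 2 * cos (2 * pi * x) + (cos (2 * pi * x) ^ 2 + sin (2 * pi * x) ^ 2)"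
      by (simp only: cmod_power2) (simp add: power2_eq_square algebra_simps)
    ultimately show ?thesis
      using sin_cos_squared_add2[of "2 * pi * x"] by (simp add: power_mult_distrib)
  qed
  ultimately show ?thesis
    by (metis abs_ge_zero norm_ge_zero power2_eq_imp_eq mult_nonneg_nonneg zero_le_numeral)
qed

text \<open>Up to 1/2 this is the cubic Taylor bound for the sine, and the symmetry \<open>x\<close>
  to \<open>1 - x\<close> gives the rest. The shape \<open>x * (1 - x)\<close> is chosen because its
  reciprocal is 1/x + 1/(1 - x), which sums to harmonic numbers over the cells.\<close>

lemma sin_pi_ge:
  assumes "0 \<le> x" "x \<le> 1"
  shows "pi * x * (1 - x) \<le> sin (pi * x)"
proof -
  have *: "pi * x * (1 - x) \<le> sin (pi * x)" if x: "0 \<le> x" "x \<le> 1 / 2" for x :: real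
  proof -
    have "\<bar>sin (pi * x) - pi * x\<bar> \<le> (pi * x) ^ 3 / 6"
      using Maclaurin_sin_bound[of "pi * x" 3] x
      by (simp add: numeral_eq_Suc sin_coeff_def inverse_eq_divide)
    hence "pi * x - (pi * x) ^ 3 / 6 \<le> sin (pi * x)" by linarith
    moreover have "(pi * x) ^ 3 / 6 \<le> pi * x * x"
    proof -
      have "pi ^ 2 \<le> 3.2 ^ 2"
        using pi_approx by (intro power_mono) auto
      hence "pi ^ 2 * x \<le> 12 * x" by (intro mult_right_mono x) (auto simp: power2_eq_square)
      also have "\<dots> \<le> 6" using x by simp
      finally have "pi ^ 2 * x / 6 \<le> 1" by simp
      hence "(pi * x * x) * (pi ^ 2 * x / 6) \<le> (pi * x * x) * 1"
        using x by (intro mult_left_mono) auto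
      thus ?thesis by (simp add: power2_eq_square power3_eq_cube mult_ac)
    qed
    ultimately show ?thesis by (simp add: algebra_simps)
  qed
  show ?thesis
  proof (cases "x \<le> 1 / 2")
    case True
    thus ?thesis using * assms by simp
  next
    case False
    have "sin (pi * (1 - x)) = sin (pi * x)"
      using sin_pi_minus[of "pi * x"] by (simp add: algebra_simps)
    thus ?thesis using *[of "1 - x"] False assms by (simp add: mult_ac)
  qed
qed

lemma harm_le: "n > 0 \<Longrightarrow> harm n \<le> 1 + ln (real n)"
  using euler_mascheroni_sequence_decreasing[of 1 n] by (simp add: harm_expand)

section \<open>Missing-digit numbers and the product formula\<close>

locale missing_digit =
  fixes g b :: nat
  assumes b_ge_2: "2 \<le> b" and b_less_g: "b < g"
begin

text \<open>All positions are tested, leading zeros included. This agrees with the condition on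
  \<open>base_digits\<close> because \<open>b\<close> is nonzero, and it can be split position by
  position.\<close>

definition good :: "nat \<Rightarrow> bool" where
  "good m \<longleftrightarrow> (\<forall>i. (m div g ^ i) mod g \<noteq> b)"

text \<open>The sum \<open>F\<^sub>i\<close> of the overview is \<open>expsum (g ^ i)\<close>; a
  general cutoff \<open>N\<close> is allowed because the length of the interval need not be a power
  of \<open>g\<close>.\<close>

definition expsum :: "nat \<Rightarrow> real \<Rightarrow> complex" where
  "expsum N \<alpha> = (\<Sum>m | m < N \<and> good m. e (real m * \<alpha>))"

lemma base_digits_iff_good: "base_digits g n \<subseteq> {0..<g} - {b} \<longleftrightarrow> good n"
proof -
  have "(n div g ^ i) mod g \<noteq> b" if "\<not> g ^ i \<le> n" for i
    using that b_ge_2 by simp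
  thus ?thesis
    unfolding base_digits_def good_def using b_less_g by (fastforce simp: subset_iff)
qed

text \<open>Positions below \<open>i\<close> see only \<open>m\<close>, position \<open>i\<close>
  sees only \<open>d\<close>, and all higher positions see 0, which differs from
  \<open>b\<close>.\<close>

lemma good_add_iff:
  assumes "m < g ^ i" "d < g"
  shows "good (d * g ^ i + m) \<longleftrightarrow> d \<noteq> b \<and> good m"
proof -
  have low: "((d * g ^ i + m) div g ^ l) mod g = (m div g ^ l) mod g" if "l < i" for l
  proof -
    have "g ^ i = (g ^ (i - l - 1) * g) * g ^ l"
      using that by (simp add: power_add [symmetric] power_Suc2 [symmetric] del: power_Suc)
    hence "d * g ^ i + m = m + (d * g ^ (i - l - 1) * g) * g ^ l"
      by (simp add: mult_ac)
    also have "\<dots> div g ^ l = (d * g ^ (i - l - 1) * g) + m div g ^ l"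
      using b_less_g by (subst div_mult_self1) auto
    finally show ?thesis by (simp add: mod_mult_self3)
  qed
  have mid: "((d * g ^ i + m) div g ^ i) mod g = d"
    using assms b_less_g by simp
  have mid': "(m div g ^ l) mod g = 0" if "l \<ge> i" for l
  proof -
    have "g ^ i \<le> g ^ l" using that b_less_g by (intro power_increasing) auto
    thus ?thesis using assms by simp
  qed
  have high: "((d * g ^ i + m) div g ^ l) mod g = 0" if "l > i" for l
  proof -
    have "d * g ^ i + m < (d + 1) * g ^ i" using assms by simp
    also have "\<dots> \<le> g * g ^ i" using assms by (intro mult_right_mono) auto
    also have "g * g ^ i = g ^ Suc i" by simp
    also have "\<dots> \<le> g ^ l" using that b_less_g by (intro power_increasing) auto
    finally show ?thesis by simp
  qed
  show ?thesis
  proof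
    assume L: "good (d * g ^ i + m)"
    have "(m div g ^ l) mod g \<noteq> b" for l
      using L low[of l] mid'[of l] b_ge_2 unfolding good_def by (cases "l < i") auto
    moreover have "d \<noteq> b" using L mid unfolding good_def by metis
    ultimately show "d \<noteq> b \<and> good m" unfolding good_def by auto
  next
    assume R: "d \<noteq> b \<and> good m"
    have "((d * g ^ i + m) div g ^ l) mod g \<noteq> b" for l
      using R low[of l] mid high[of l] b_ge_2 unfolding good_def
      by (cases l i rule: linorder_cases) auto
    thus "good (d * g ^ i + m)" unfolding good_def by blast
  qed
qed

lemma good_0: "good 0"
  using b_ge_2 by (simp add: good_def)

text \<open>The numbers added beyond \<open>t * g ^ i\<close> all have digit \<open>t\<close> at
  position \<open>i\<close>: none survives if \<open>t = b\<close>, otherwise they form a translate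
  of the good numbers below \<open>n\<close>. A full block, \<open>n = g ^ i\<close>, is
  included.\<close>

lemma expsum_add:
  assumes "n \<le> g ^ i" "t < g"
  shows "expsum (t * g ^ i + n) \<alpha> =
    expsum (t * g ^ i) \<alpha> + (if t = b then 0 else e (real (t * g ^ i) * \<alpha>) * expsum n \<alpha>)"
proof -
  have *: "{m. m < t * g ^ i + n \<and> good m} = {m. m < t * g ^ i \<and> good m} \<union>
      (\<lambda>m. t * g ^ i + m) ` {m. m < n \<and> t \<noteq> b \<and> good m}" (is "?L = ?A \<union> ?B")
  proof (intro equalityI subsetI)
    fix m assume m: "m \<in> ?L"
    show "m \<in> ?A \<union> ?B"
    proof (cases "m < t * g ^ i")
      case False
      then obtain r where r: "m = t * g ^ i + r" using le_Suc_ex not_less by blast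
      with m good_add_iff[of r i t] assms show ?thesis by auto
    qed (use m in auto)
  next
    fix m assume "m \<in> ?A \<union> ?B"
    thus "m \<in> ?L" using good_add_iff[of _ i t] assms by auto
  qed
  have "expsum (t * g ^ i + n) \<alpha> = (\<Sum>m\<in>?A. e (real m * \<alpha>)) + (\<Sum>m\<in>?B. e (real m * \<alpha>))"
    unfolding expsum_def * by (rule sum.union_disjoint) auto
  also have "(\<Sum>m\<in>?B. e (real m * \<alpha>)) =
      (\<Sum>m | m < n \<and> t \<noteq> b \<and> good m. e (real (t * g ^ i) * \<alpha>) * e (real m * \<alpha>))"
    by (subst sum.reindex) (auto simp: e_add [symmetric] algebra_simps intro: inj_onI)
  finally show ?thesis by (auto simp: expsum_def sum_distrib_left)
qed

lemma expsum_0 [simp]: "expsum 0 \<alpha> = 0"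
  by (simp add: expsum_def)

text \<open>Full blocks are added one leading digit at a time. The case \<open>t = g\<close> is the
  recursion behind the product formula; smaller \<open>t\<close> serve the incomplete sums.\<close>

lemma expsum_mult:
  "t \<le> g \<Longrightarrow> expsum (t * g ^ i) \<alpha> =
    (\<Sum>d\<in>{..<t} - {b}. e (real d * (real g ^ i * \<alpha>))) * expsum (g ^ i) \<alpha>"
proof (induction t)
  case (Suc t)
  have "expsum (Suc t * g ^ i) \<alpha> = expsum (t * g ^ i) \<alpha> +
      (if t = b then 0 else e (real (t * g ^ i) * \<alpha>) * expsum (g ^ i) \<alpha>)"
    using expsum_add[of "g ^ i" i t \<alpha>] Suc.prems by (simp add: add_ac)
  also have "expsum (t * g ^ i) \<alpha> =
    (\<Sum>d\<in>{..<t} - {b}. e (real d * (real g ^ i * \<alpha>))) * expsum (g ^ i) \<alpha>"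
    using Suc by simp
  also have "{..<Suc t} - {b} = (if t = b then {..<t} - {b} else insert t ({..<t} - {b}))"
    by auto
  ultimately show ?case
    by (auto simp: algebra_simps)
qed auto

text \<open>The factor of one digit position in the product formula: a geometric sum of length
  \<open>g\<close> with the frequency \<open>b\<close> removed.\<close>

definition digit_sum :: "real \<Rightarrow> complex" where
  "digit_sum x = (\<Sum>d\<in>{..<g} - {b}. e (real d * x))"

lemma expsum_power_Suc: "expsum (g ^ Suc i) \<alpha> = digit_sum (real g ^ i * \<alpha>) * expsum (g ^ i) \<alpha>"
  using expsum_mult[of g i \<alpha>] by (simp add: digit_sum_def)

lemma expsum_1 [simp]: "expsum (Suc 0) \<alpha> = 1"
proof -
  have "{m. m = 0 \<and> good m} = {0}" using good_0 by auto
  thus ?thesis by (simp add: expsum_def)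
qed

text \<open>Splitting off the leading digit of the cutoff leaves at most \<open>g\<close> full
  blocks and a cutoff with fewer digits, so incomplete sums reduce to the complete ones.\<close>

lemma norm_expsum_le:
  "N < g ^ J \<Longrightarrow> norm (expsum N \<alpha>) \<le> real g * (\<Sum>i<J. norm (expsum (g ^ i) \<alpha>))"
proof (induction J arbitrary: N)
  case (Suc J)
  define t where "t = N div g ^ J"
  define n where "n = N mod g ^ J"
  have g: "g > 0" using b_less_g by simp
  have N: "N = t * g ^ J + n" unfolding t_def n_def by (rule div_mult_mod_eq [symmetric])
  have n: "n < g ^ J" using g by (simp add: n_def)
  have t: "t < g" using Suc.prems g by (simp add: t_def less_mult_imp_div_less)
  have "norm (\<Sum>d\<in>{..<t} - {b}. e (real d * (real g ^ J * \<alpha>))) \<le> real (card ({..<t} - {b}))"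
    by (rule order.trans[OF norm_sum]) simp
  also have "card ({..<t} - {b}) \<le> card {..<t}" by (intro card_mono) auto
  hence "real (card ({..<t} - {b})) \<le> real g" using t by simp
  finally have 1: "norm (expsum (t * g ^ J) \<alpha>) \<le> real g * norm (expsum (g ^ J) \<alpha>)"
    using t by (simp add: expsum_mult norm_mult mult_right_mono)
  have 2: "norm (if t = b then 0 else e (real (t * g ^ J) * \<alpha>) * expsum n \<alpha>) \<le> norm (expsum n \<alpha>)"
    by (auto simp: norm_mult)
  have "expsum N \<alpha> = expsum (t * g ^ J) \<alpha> + (if t = b then 0 else e (real (t * g ^ J) * \<alpha>) * expsum n \<alpha>)"
    unfolding N using n t by (intro expsum_add) auto
  hence "norm (expsum N \<alpha>) \<le> real g * norm (expsum (g ^ J) \<alpha>) + norm (expsum n \<alpha>)"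
    using 1 2 norm_triangle_mono by metis
  also have "norm (expsum n \<alpha>) \<le> real g * (\<Sum>i<J. norm (expsum (g ^ i) \<alpha>))"
    using Suc.IH n by blast
  finally show ?case by (simp add: algebra_simps)
qed auto

lemma digit_sum_0: "digit_sum 0 = of_nat (g - 1)"
  using b_less_g by (simp add: digit_sum_def)

lemma expsum_at_0: "expsum N 0 = of_nat (card {m. m < N \<and> good m})"
  by (simp add: expsum_def)

text \<open>The product formula at frequency 0, where every digit factor equals
  \<open>g - 1\<close>.\<close>

lemma card_good_power: "card {m. m < g ^ i \<and> good m} = (g - 1) ^ i"
proof -
  have "expsum (g ^ i) 0 = of_nat ((g - 1) ^ i)"
    by (induction i) (simp_all add: expsum_power_Suc digit_sum_0 del: power_Suc, simp)
  thus ?thesis unfolding expsum_at_0 by (simp only: of_nat_eq_iff)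
qed

lemma norm_digit_sum_le: "norm (digit_sum x) \<le> real g - 1"
proof -
  have "norm (digit_sum x) \<le> (\<Sum>d\<in>{..<g} - {b}. norm (e (real d * x)))"
    unfolding digit_sum_def by (rule norm_sum)
  also have "\<dots> = real g - 1" using b_less_g by (simp add: of_nat_diff)
  finally show ?thesis .
qed

lemma digit_sum_add_int: "digit_sum (x + of_int k) = digit_sum x"
proof -
  have "e (real d * (x + of_int k)) = e (real d * x)" for d
    using e_add_int[of "real d * x" "int d * k"] by (simp add: algebra_simps)
  thus ?thesis by (simp add: digit_sum_def)
qed

text \<open>The digit factors of the top \<open>i - m\<close> positions are bounded
  trivially.\<close>

lemma norm_expsum_power_le:
  assumes "m \<le> i"
  shows "norm (expsum (g ^ i) \<alpha>) \<le> (real g - 1) ^ (i - m) * norm (expsum (g ^ m) \<alpha>)"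
  using assms
proof (induction i rule: dec_induct)
  case (step i)
  have "norm (expsum (g ^ Suc i) \<alpha>) =
      norm (digit_sum (real g ^ i * \<alpha>)) * norm (expsum (g ^ i) \<alpha>)"
    by (simp add: expsum_power_Suc norm_mult del: power_Suc)
  also have "\<dots> \<le> (real g - 1) * ((real g - 1) ^ (i - m) * norm (expsum (g ^ m) \<alpha>))"
    using b_less_g by (intro mult_mono norm_digit_sum_le step.IH) auto
  also have "\<dots> = (real g - 1) ^ (Suc i - m) * norm (expsum (g ^ m) \<alpha>)"
    using step.hyps by (simp add: Suc_diff_le)
  finally show ?case .
qed auto

text \<open>Bounding the digit sum by its supremum over each cell \<open>[j/g, (j+1)/g)\<close>, rather than at
  single points, makes the product over all digit positions independent of where a point lies
  inside its cell, so that no integral large sieve is needed.  The sum over the cells has leading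
  term \<open>(2/3) g ln g\<close>; that the factor is below \<open>1\<close> is what large \<open>g\<close> is needed for.\<close>

definition cell_bound :: "nat \<Rightarrow> real" where
  "cell_bound j = (if j = 0 \<or> Suc j = g then real g
     else 1 + (real g / real j + real g / real (g - 1 - j)) / 3)"

lemma cell_bound_nonneg: "cell_bound j \<ge> 0"
  by (auto simp: cell_bound_def intro!: add_nonneg_nonneg)

text \<open>Over all digits the sum is a geometric series of norm at most 1/sin(pi x), and removing
  the digit \<open>b\<close> costs 1. By \<open>sin_pi_ge\<close> and pi > 3 the series is
  controlled by 1/x and 1/(1 - x), each taken at the worse end of the cell. The two outer cells get
  the trivial bound.\<close>

lemma norm_digit_sum_le_cell_bound:
  assumes "j < g" "real j / real g \<le> x" "x < real (Suc j) / real g"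
  shows "norm (digit_sum x) \<le> cell_bound j"
proof (cases "j = 0 \<or> Suc j = g")
  case True
  thus ?thesis using norm_digit_sum_le[of x] by (auto simp: cell_bound_def)
next
  case False
  hence j: "0 < j" "Suc j < g" using assms(1) by auto
  have g: "real g > 0" using b_less_g by simp
  have x0: "0 < x" using j g assms(2) by (smt (verit) divide_pos_pos of_nat_0_less_iff)
  have "real (Suc j) / real g \<le> 1" using j by simp
  hence x1: "x < 1" using assms(3) by linarith
  have s: "0 < pi * x * (1 - x)" using x0 x1 by simp
  have s': "pi * x * (1 - x) \<le> sin (pi * x)" using sin_pi_ge x0 x1 by simp
  have sp: "sin (pi * x) > 0" using s s' by linarith
  have ne: "e x \<noteq> 1" using norm_one_minus_e[of x] sp by auto
  define D where "D = (\<Sum>d<g. e (real d * x))"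
  have "D = (\<Sum>d<g. e x ^ d)" by (simp add: D_def e_power)
  hence "D = (1 - e x ^ g) / (1 - e x)" using ne by (simp add: sum_gp_strict)
  hence "norm D = norm (1 - e x ^ g) / (2 * sin (pi * x))"
    using sp by (simp add: norm_divide norm_one_minus_e)
  also have "norm (1 - e x ^ g) \<le> 2"
    using norm_triangle_ineq4[of 1 "e x ^ g"] by (simp add: norm_power)
  hence "norm (1 - e x ^ g) / (2 * sin (pi * x)) \<le> 2 / (2 * sin (pi * x))"
    using sp by (intro divide_right_mono) auto
  also have "\<dots> = 1 / sin (pi * x)" by simp
  also have "\<dots> \<le> 1 / (pi * x * (1 - x))"
    using s s' by (intro divide_left_mono) auto
  also have "\<dots> = (1 / x + 1 / (1 - x)) / pi"
    using x0 x1 by (simp add: field_simps)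
  also have "\<dots> \<le> (1 / x + 1 / (1 - x)) / 3"
    using pi_approx x0 x1 by (intro divide_left_mono) auto
  also have "1 / x \<le> real g / real j"
    using assms(2) x0 j g by (simp add: field_simps)
  also have "1 / (1 - x) \<le> real g / real (g - 1 - j)"
    using assms(3) x1 j g by (simp add: field_simps of_nat_diff)
  finally have D: "norm D \<le> (real g / real j + real g / real (g - 1 - j)) / 3" by simp
  have "digit_sum x = D - e (real b * x)"
    unfolding digit_sum_def D_def using b_less_g by (simp add: sum_diff1)
  hence "norm (digit_sum x) \<le> norm D + 1"
    using norm_triangle_ineq4[of D "e (real b * x)"] by simp
  also note D
  finally show ?thesis using False by (simp add: cell_bound_def)
qed

text \<open>The outer cells contribute 2g and the \<open>g - 2\<close> inner ones at most g + (2/3)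
  g (1 + ln g). The total g (11/3 + (2/3) ln g) is at most g (ln g + 1) exactly when ln g is at
  least 8.\<close>

lemma sum_cell_bound:
  assumes "8 \<le> ln (real g)"
  shows "(\<Sum>j<g. cell_bound j) \<le> real g * (ln (real g) + 1)"
proof -
  obtain h where h: "g = Suc (Suc h)" "h > 0"
    using b_ge_2 b_less_g by (intro that[of "g - 2"]) auto
  have harm1: "(\<Sum>j<h. real g / real (Suc j)) = real g * harm h"
    unfolding harm_altdef by (simp add: sum_distrib_left divide_inverse)
  have harm2: "(\<Sum>j<h. real g / real (h - j)) = real g * harm h"
  proof -
    have "(\<Sum>j<h. real g / real (h - j)) = (\<Sum>j<h. real g / real (h - (h - Suc j)))"
      by (rule sum.nat_diff_reindex [symmetric])
    also have "\<dots> = (\<Sum>j<h. real g / real (Suc j))"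
      by (intro sum.cong) auto
    finally show ?thesis using harm1 by simp
  qed
  have "(\<Sum>j<Suc (Suc h). cell_bound j) = cell_bound 0 + (\<Sum>j<h. cell_bound (Suc j)) + cell_bound (Suc h)"
    by (subst sum.lessThan_Suc_shift) simp
  also have "cell_bound 0 = real g" by (simp add: cell_bound_def)
  also have "cell_bound (Suc h) = real g" unfolding cell_bound_def using h(1) by simp
  also have "(\<Sum>j<h. cell_bound (Suc j)) = (\<Sum>j<h. 1 + (real g / real (Suc j) + real g / real (h - j)) / 3)"
    unfolding cell_bound_def using h(1) by (intro sum.cong) auto
  also have "\<dots> = real h + 2 / 3 * real g * harm h"
    by (simp only: sum.distrib sum_divide_distrib [symmetric] harm1 harm2) simp
  also have "harm h \<le> 1 + ln (real g)"
    using harm_le[OF h(2)] h by (smt (verit) ln_le_cancel_iff of_nat_0_less_iff of_nat_Suc)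
  hence "2 / 3 * real g * harm h \<le> 2 / 3 * real g * (1 + ln (real g))"
    by (intro mult_left_mono) auto
  also have "real g + (real h + 2 / 3 * real g * (1 + ln (real g))) + real g \<le>
      real g * (11 / 3 + 2 / 3 * ln (real g))"
  proof -
    have "real h \<le> real g" using h by simp
    thus ?thesis by (simp add: field_simps)
  qed
  also have "\<dots> \<le> real g * (ln (real g) + 1)"
    using assms by (intro mult_left_mono) auto
  finally show ?thesis using h by simp
qed

end

section \<open>Exponential sums at separated points\<close>

lemma sum_mod_div:
  fixes f :: "nat \<Rightarrow> nat \<Rightarrow> real"
  shows "(\<Sum>t<n * k. f (t mod k) (t div k)) = (\<Sum>s<n. \<Sum>j<k. f j s)"
proof -
  have "(\<Sum>t\<in>{s * k..<s * k + k}. f (t mod k) (t div k)) = (\<Sum>j<k. f j s)" for s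
    by (rule sum.reindex_bij_witness[of _ "\<lambda>j. s * k + j" "\<lambda>t. t mod k"])
       (auto simp: mod_less_divisor modulo_nat_def div_nat_eqI mult.commute)
  thus ?thesis by (simp flip: sum.nat_group)
qed

lemma sum_powers_le:
  fixes x :: real
  assumes "x \<ge> 2"
  shows "(\<Sum>i\<le>n. x ^ i) \<le> 2 * x ^ n"
proof (induction n)
  case (Suc n)
  have "2 * x ^ n \<le> x * x ^ n" using assms by (intro mult_right_mono) auto
  thus ?case using Suc by simp
qed auto

lemma sum_powers_less:
  fixes x :: real
  assumes "x \<ge> 2"
  shows "(\<Sum>i<n. x ^ i) \<le> x ^ n"
proof (induction n)
  case (Suc n)
  have "2 * x ^ n \<le> x * x ^ n" using assms by (intro mult_right_mono) auto
  thus ?case using Suc by simp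
qed auto

context missing_digit
begin

section \<open>Cells of the unit interval as digit strings\<close>

lemma expsum_frac: "expsum N (frac \<alpha>) = expsum N \<alpha>"
proof -
  have "e (real m * frac \<alpha>) = e (real m * \<alpha>)" for m
    using e_add_int[of "real m * frac \<alpha>" "int m * \<lfloor>\<alpha>\<rfloor>"] by (simp add: frac_def algebra_simps)
  thus ?thesis by (simp add: expsum_def)
qed

text \<open>Here \<open>t\<close> indexes a cell of length 1/g^i. Its base-\<open>g\<close> digits,
  from the lowest up, locate the fractional parts of \<open>g ^ (i - 1) * \<alpha>\<close>,
  \<open>g ^ (i - 2) * \<alpha>\<close>, and so on, for a point \<open>\<alpha>\<close> of the
  cell.\<close>

primrec cell_prod :: "nat \<Rightarrow> nat \<Rightarrow> real" where
  "cell_prod 0 t = 1"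
| "cell_prod (Suc i) t = cell_bound (t mod g) * cell_prod i (t div g)"

lemma cell_prod_nonneg: "cell_prod i t \<ge> 0"
  by (induction i arbitrary: t) (auto intro: mult_nonneg_nonneg cell_bound_nonneg)

text \<open>Dropping the \<open>l\<close> lowest digits of the index of a fine cell gives the
  coarser cell that contains it.\<close>

lemma nat_floor_power_div:
  assumes "\<alpha> \<ge> 0"
  shows "nat \<lfloor>real g ^ (i + l) * \<alpha>\<rfloor> div g ^ l = nat \<lfloor>real g ^ i * \<alpha>\<rfloor>"
proof -
  have "\<lfloor>(real g ^ (i + l) * \<alpha>) / real_of_int (int (g ^ l))\<rfloor> = \<lfloor>real g ^ (i + l) * \<alpha>\<rfloor> div int (g ^ l)"
    by (rule floor_divide_real_eq_div) simp
  also have "(real g ^ (i + l) * \<alpha>) / real_of_int (int (g ^ l)) = real g ^ i * \<alpha>"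
    using b_less_g by (simp add: power_add)
  finally have "nat \<lfloor>real g ^ i * \<alpha>\<rfloor> = nat (\<lfloor>real g ^ (i + l) * \<alpha>\<rfloor> div int (g ^ l))" by simp
  also have "\<dots> = nat \<lfloor>real g ^ (i + l) * \<alpha>\<rfloor> div g ^ l"
    using assms by (subst nat_div_distrib) (auto simp: nat_power_eq)
  finally show ?thesis by simp
qed

text \<open>The lowest digit of the index bounds the newest digit factor, whose argument may be
  reduced modulo 1; the remaining digits index the cell for the shorter product.\<close>

lemma norm_expsum_le_cell_prod:
  assumes "\<alpha> \<ge> 0"
  shows "norm (expsum (g ^ i) \<alpha>) \<le> cell_prod i (nat \<lfloor>real g ^ i * \<alpha>\<rfloor>)"
proof (induction i)
  case (Suc i)
  have g: "real g > 0" using b_less_g by simp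
  define t where "t = nat \<lfloor>real g ^ Suc i * \<alpha>\<rfloor>"
  have td: "t div g = nat \<lfloor>real g ^ i * \<alpha>\<rfloor>"
    using nat_floor_power_div[OF assms, of i 1] by (simp add: t_def)
  have t: "real t \<le> real g ^ Suc i * \<alpha>" "real g ^ Suc i * \<alpha> < real t + 1"
    using assms unfolding t_def by (auto simp del: power_Suc)
  have tt: "real t = real g * real (t div g) + real (t mod g)"
    by (metis mult_div_mod_eq of_nat_add of_nat_mult)
  have "norm (digit_sum (real g ^ i * \<alpha> - real (t div g))) \<le> cell_bound (t mod g)"
  proof (rule norm_digit_sum_le_cell_bound)
    show "t mod g < g" using b_less_g by simp
    show "real (t mod g) / real g \<le> real g ^ i * \<alpha> - real (t div g)"
      using t(1) tt g by (simp add: field_simps)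
    show "real g ^ i * \<alpha> - real (t div g) < real (Suc (t mod g)) / real g"
      using t(2) tt g by (simp add: field_simps)
  qed
  moreover have "digit_sum (real g ^ i * \<alpha> - real (t div g)) = digit_sum (real g ^ i * \<alpha>)"
    using digit_sum_add_int[of "real g ^ i * \<alpha>" "- int (t div g)"] by simp
  ultimately have "norm (expsum (g ^ Suc i) \<alpha>) \<le> cell_bound (t mod g) * cell_prod i (t div g)"
    unfolding td using Suc.IH
    by (simp add: expsum_power_Suc norm_mult cell_bound_nonneg mult_mono del: power_Suc)
  thus ?case by (simp add: t_def)
qed auto

text \<open>Summing a product over all digit strings factorises digit by digit.\<close>

lemma sum_cell_prod: "(\<Sum>t<g ^ i. cell_prod i t) = (\<Sum>j<g. cell_bound j) ^ i"
proof (induction i)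
  case (Suc i)
  have "(\<Sum>t<g ^ i * g. cell_prod (Suc i) t) = (\<Sum>s<g ^ i. \<Sum>j<g. cell_bound j * cell_prod i s)"
    unfolding cell_prod.simps by (rule sum_mod_div)
  also have "\<dots> = (\<Sum>j<g. cell_bound j) * (\<Sum>s<g ^ i. cell_prod i s)"
    by (simp only: sum_distrib_right [symmetric] sum_distrib_left [symmetric])
  finally show ?case using Suc.IH by (simp add: mult.commute)
qed auto

lemma sum_cell_prod_div:
  "(\<Sum>t<g ^ (i + l). cell_prod i (t div g ^ l)) = real (g ^ l) * (\<Sum>j<g. cell_bound j) ^ i"
proof -
  have "(\<Sum>t<g ^ i * g ^ l. cell_prod i (t div g ^ l)) = (\<Sum>s<g ^ i. \<Sum>j<g ^ l. cell_prod i s)"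
    by (rule sum_mod_div)
  also have "\<dots> = real (g ^ l) * (\<Sum>s<g ^ i. cell_prod i s)"
    by (simp add: sum_distrib_left)
  finally show ?thesis by (simp only: power_add sum_cell_prod)
qed

text \<open>The injectivity hypothesis puts the points into distinct cells of length 1/g^m. If
  \<open>m \<le> i\<close>, the top digit factors are estimated trivially and the others summed over
  all cells. Otherwise only the coarser cell of length 1/g^i matters, and it contains g^(m - i) of
  the fine ones.\<close>

lemma sum_norm_expsum_separated:
  fixes \<alpha> :: "'a \<Rightarrow> real"
  assumes "8 \<le> ln (real g)"
    and inj: "inj_on (\<lambda>x. nat \<lfloor>real g ^ m * frac (\<alpha> x)\<rfloor>) I"
  shows "(\<Sum>x\<in>I. norm (expsum (g ^ i) (\<alpha> x))) \<le>
    (if m \<le> i then (real g - 1) ^ (i - m) * (real g * (ln (real g) + 1)) ^ m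
     else real g ^ m * (ln (real g) + 1) ^ i)"
proof -
  define T where "T = (\<lambda>x. nat \<lfloor>real g ^ m * frac (\<alpha> x)\<rfloor>)"
  have L0: "ln (real g) + 1 \<ge> 0" using assms(1) by simp
  have g: "real g > 1" using b_less_g b_ge_2 by simp
  have S0: "0 \<le> (\<Sum>j<g. cell_bound j)" by (intro sum_nonneg cell_bound_nonneg)
  have T_less: "T x < g ^ m" for x
  proof -
    have "real g ^ m * frac (\<alpha> x) < real g ^ m * 1"
      using g by (intro mult_strict_left_mono frac_lt_1) auto
    hence "\<lfloor>real g ^ m * frac (\<alpha> x)\<rfloor> < int (g ^ m)" by (simp add: floor_less_iff)
    thus ?thesis unfolding T_def by (simp add: nat_less_iff)
  qed
  have img: "T ` I \<subseteq> {..<g ^ m}" using T_less by auto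
  have sumT: "(\<Sum>x\<in>I. h (T x)) \<le> (\<Sum>t<g ^ m. h t)" if "\<And>t. h t \<ge> 0" for h :: "nat \<Rightarrow> real"
  proof -
    have "(\<Sum>x\<in>I. h (T x)) = sum h (T ` I)"
      using inj by (simp add: sum.reindex T_def)
    also have "\<dots> \<le> (\<Sum>t<g ^ m. h t)"
      using img that by (intro sum_mono2) auto
    finally show ?thesis .
  qed
  show ?thesis
  proof (cases "m \<le> i")
    case True
    have "norm (expsum (g ^ i) (\<alpha> x)) \<le> (real g - 1) ^ (i - m) * cell_prod m (T x)" for x
    proof -
      have "norm (expsum (g ^ m) (frac (\<alpha> x))) \<le> cell_prod m (T x)"
        unfolding T_def by (rule norm_expsum_le_cell_prod) simp
      hence "(real g - 1) ^ (i - m) * norm (expsum (g ^ m) (\<alpha> x)) \<le>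
          (real g - 1) ^ (i - m) * cell_prod m (T x)"
        using g by (intro mult_left_mono) (auto simp: expsum_frac)
      thus ?thesis using norm_expsum_power_le[OF True, of "\<alpha> x"] by linarith
    qed
    hence "(\<Sum>x\<in>I. norm (expsum (g ^ i) (\<alpha> x))) \<le>
        (\<Sum>x\<in>I. (real g - 1) ^ (i - m) * cell_prod m (T x))" by (rule sum_mono)
    also have "\<dots> = (real g - 1) ^ (i - m) * (\<Sum>x\<in>I. cell_prod m (T x))"
      by (simp add: sum_distrib_left)
    also have "\<dots> \<le> (real g - 1) ^ (i - m) * (\<Sum>t<g ^ m. cell_prod m t)"
      using g by (intro mult_left_mono sumT cell_prod_nonneg) auto
    also have "\<dots> \<le> (real g - 1) ^ (i - m) * (real g * (ln (real g) + 1)) ^ m"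
      unfolding sum_cell_prod using g assms(1) S0
      by (intro mult_left_mono power_mono sum_cell_bound) auto
    finally show ?thesis using True by simp
  next
    case False
    define l where "l = m - i"
    have m: "m = i + l" using False by (simp add: l_def)
    have "norm (expsum (g ^ i) (\<alpha> x)) \<le> cell_prod i (T x div g ^ l)" for x
      using norm_expsum_le_cell_prod[of "frac (\<alpha> x)" i] nat_floor_power_div[of "frac (\<alpha> x)" i l]
      by (simp add: expsum_frac T_def m)
    hence "(\<Sum>x\<in>I. norm (expsum (g ^ i) (\<alpha> x))) \<le> (\<Sum>x\<in>I. cell_prod i (T x div g ^ l))"
      by (rule sum_mono)
    also have "\<dots> \<le> (\<Sum>t<g ^ m. cell_prod i (t div g ^ l))"
      by (intro sumT cell_prod_nonneg)
    also have "\<dots> \<le> real (g ^ l) * (real g * (ln (real g) + 1)) ^ i"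
      unfolding m sum_cell_prod_div using S0 assms(1)
      by (intro mult_left_mono power_mono sum_cell_bound) auto
    also have "\<dots> = real g ^ m * (ln (real g) + 1) ^ i"
      by (simp add: m power_add power_mult_distrib)
    finally show ?thesis using False by simp
  qed
qed

section \<open>Separation of reduced fractions with denominators of equal size\<close>

definition reduced_fractions :: "nat \<Rightarrow> (nat \<times> nat) set" where
  "reduced_fractions s = (SIGMA q:{g ^ s..<g ^ Suc s}. {a. 1 \<le> a \<and> a \<le> q \<and> coprime a q})"

text \<open>Distinct reduced fractions differ modulo 1 by at least 1/(q q'). Lying in one cell
  contributes at most 1/3 to q q' times their distance and the two shifts at most 1/4 each; since
  the total is below 1, the integer \<open>D\<close> must vanish.\<close>

lemma reduced_fractions_separated:
  assumes \<beta>: "\<And>q. q \<ge> 1 \<Longrightarrow> \<bar>\<beta> q\<bar> \<le> 1 / (4 * real g * real q ^ 2)"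
  shows "inj_on (\<lambda>(q, a). nat \<lfloor>real g ^ (2 * s + 3) * frac (real a / real q - \<beta> q)\<rfloor>)
    (reduced_fractions s)"
proof (rule inj_onI, clarify)
  fix q a q' a'
  assume mem: "(q, a) \<in> reduced_fractions s" "(q', a') \<in> reduced_fractions s"
  define x where "x = real a / real q - \<beta> q"
  define y where "y = real a' / real q' - \<beta> q'"
  define m where "m = 2 * s + 3"
  assume "nat \<lfloor>real g ^ (2 * s + 3) * frac (real a / real q - \<beta> q)\<rfloor> =
      nat \<lfloor>real g ^ (2 * s + 3) * frac (real a' / real q' - \<beta> q')\<rfloor>"
  hence "\<lfloor>real g ^ m * frac x\<rfloor> = \<lfloor>real g ^ m * frac y\<rfloor>"
    unfolding x_def y_def m_def by (subst (asm) eq_nat_nat_iff) auto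
  hence fl: "\<bar>real g ^ m * frac x - real g ^ m * frac y\<bar> < 1" by linarith
  have g3: "real g \<ge> 3" using b_ge_2 b_less_g by simp
  have q: "g ^ s \<le> q" "q < g ^ Suc s" "1 \<le> a" "a \<le> q" "coprime a q"
    and q': "g ^ s \<le> q'" "q' < g ^ Suc s" "1 \<le> a'" "a' \<le> q'" "coprime a' q'"
    using mem by (auto simp: reduced_fractions_def)
  have q0: "real q > 0" "real q' > 0" using q q' by linarith+
  define z where "z = \<lfloor>x\<rfloor> - \<lfloor>y\<rfloor>"
  \<comment> \<open>This is q q' times the difference of the unshifted fractions, reduced by the
    integer \<open>z\<close> because the cells only see points modulo 1.\<close>
  define D where "D = int a * int q' - int a' * int q - z * int q * int q'"
  have "frac x - frac y = x - y - real_of_int z"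
    by (simp add: frac_def z_def)
  hence "\<bar>real g ^ m * (x - y - real_of_int z)\<bar> < 1" using fl by (metis right_diff_distrib)
  hence small: "\<bar>x - y - real_of_int z\<bar> < 1 / real g ^ m"
    using g3 by (simp add: abs_mult pos_less_divide_eq mult.commute)
  \<comment> \<open>The product q q' is at most g^(2s + 2), so the exponent 2s + 3 leaves a spare
    factor 1/g.\<close>
  have qq: "real q * real q' * \<bar>x - y - real_of_int z\<bar> \<le> 1 / 3"
  proof -
    have "real q \<le> real g ^ Suc s" "real q' \<le> real g ^ Suc s"
      using q(2) q'(2) by (metis less_imp_le of_nat_mono of_nat_power)+
    hence prod: "real q * real q' \<le> real g ^ Suc s * real g ^ Suc s"
      by (intro mult_mono) auto
    have "real q * real q' * \<bar>x - y - real_of_int z\<bar> \<le> (real g ^ Suc s * real g ^ Suc s) * (1 / real g ^ m)"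
      by (rule mult_mono[OF prod]) (use small in auto)
    also have "\<dots> = 1 / real g"
      using g3 by (simp add: m_def power_add field_simps power_mult power2_eq_square power3_eq_cube power_mult_distrib)
    also have "\<dots> \<le> 1 / 3" using g3 by (intro divide_left_mono) auto
    finally show ?thesis .
  qed
  \<comment> \<open>Both denominators lie in one block, hence \<open>q' \<le> g * q\<close>; this is
    why the admissible shift carries a factor 1/g.\<close>
  have shift: "real q * real q' * \<bar>\<beta> q\<bar> \<le> 1 / 4"
    if "g ^ s \<le> q" "q' < g ^ Suc s" "real q > 0" for q q' :: nat
  proof -
    have "q' \<le> g * g ^ s" using that by simp
    also have "\<dots> \<le> g * q" using that by (intro mult_left_mono) auto
    finally have "q' \<le> g * q" .
    hence le: "real q' \<le> real g * real q" by (simp flip: of_nat_mult)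
    have "real q * real q' * \<bar>\<beta> q\<bar> \<le> real q * real q' * (1 / (4 * real g * real q ^ 2))"
      using \<beta>[of q] that by (intro mult_left_mono) auto
    also have "\<dots> = real q' / (4 * (real g * real q))"
      using that by (simp add: power2_eq_square field_simps)
    also have "\<dots> \<le> 1 / 4" using le that g3 by (simp add: field_simps)
    finally show ?thesis .
  qed
  have "real_of_int D = real q * real q' * (x - y - real_of_int z) + real q * real q' * \<beta> q
      - real q * real q' * \<beta> q'"
    using q0 by (simp add: D_def x_def y_def field_simps)
  hence "\<bar>real_of_int D\<bar> \<le> real q * real q' * \<bar>x - y - real_of_int z\<bar> + real q * real q' * \<bar>\<beta> q\<bar>
      + real q * real q' * \<bar>\<beta> q'\<bar>"
    using q0 abs_mult[of "real q * real q'"] by (smt (verit) mult_nonneg_nonneg)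
  also have "\<dots> < 1"
    using qq shift[OF q(1) q'(2) q0(1)] shift[OF q'(1) q(2) q0(2)] by (simp add: mult_ac)
  finally have D: "D = 0" by linarith
  hence e1: "int a * int q' = int q * (int a' + z * int q')"
    and e2: "int a' * int q = int q' * (int a - z * int q)"
    by (simp_all add: D_def algebra_simps)
  have "int q dvd int q'" "int q' dvd int q"
    using e1 e2 q(5) q'(5) by (metis coprime_commute coprime_dvd_mult_right_iff coprime_int_iff dvd_triv_left)+
  hence qeq: "q = q'" by (simp add: dvd_antisym)
  hence "int q * int a = int q * (int a' + z * int q)" using e1 by (simp add: mult.commute)
  hence aeq: "int a = int a' + z * int q" using q0 by simp
  \<comment> \<open>Both numerators lie between 1 and \<open>q\<close>, so congruent ones
    coincide.\<close>
  have "\<bar>z * int q\<bar> < int q" using aeq q q' qeq by linarith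
  hence "z = 0" using q0 by (simp add: abs_mult)
  thus "q = q' \<and> a = a'" using qeq aeq by simp
qed

end

text \<open>What a large base has to provide: \<open>ln_base\<close> bounds the sum over the cells,
  \<open>ratio\<close> gives geometric decay over blocks of denominators, and \<open>lambda\<close>
  keeps the exponent 1/(2 lambda) at most 3/4.\<close>

locale large_base = missing_digit +
  assumes ln_base: "8 \<le> ln (real g)"
    and ratio: "2 * (real g * (ln (real g) + 1) / (real g - 1)) ^ 2 \<le> real g"
    and lambda: "2 / 3 \<le> lambda_exp g"
begin

definition L :: real where "L = ln (real g) + 1"

lemma L_ge: "L \<ge> 9" using ln_base by (simp add: L_def)

lemma g_ge: "real g \<ge> 9"
  using ln_base ln_le_minus_one[of "real g"] b_less_g by simp

lemma sum_power_blocks: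
  fixes w :: "nat \<Rightarrow> real"
  shows "(\<Sum>q\<in>{1..<g ^ K}. w q) = (\<Sum>s<K. \<Sum>q\<in>{g ^ s..<g ^ Suc s}. w q)"
proof (induction K)
  case (Suc K)
  have "1 \<le> g ^ K" "g ^ K \<le> g ^ Suc K" using g_ge by auto
  hence "(\<Sum>q\<in>{1..<g ^ Suc K}. w q) = (\<Sum>q\<in>{1..<g ^ K}. w q) + (\<Sum>q\<in>{g ^ K..<g ^ Suc K}. w q)"
    by (rule sum.atLeastLessThan_concat [symmetric])
  thus ?case using Suc by simp
qed auto

text \<open>The first summand serves the blocks with \<open>2 * s + 3 \<le> i\<close>, its factor 2
  being a geometric series; the second serves the remaining blocks.\<close>

definition C\<^sub>V :: real where "C\<^sub>V = 2 * (real g * L / (real g - 1)) ^ 3 + real g ^ 3"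

lemma C\<^sub>V_nonneg: "C\<^sub>V \<ge> 0"
  using g_ge L_ge by (auto simp: C\<^sub>V_def)

text \<open>In the block starting at g^s the weight 1/q is about 1/g^s and the points occupy
  distinct cells of length 1/g^(2s + 3). Small \<open>s\<close> give a series with ratio at most
  1/2, by \<open>ratio\<close>; large \<open>s\<close> give terms of order g^s L^i, which sum to
  order g^K L^i.\<close>

lemma weighted_fraction_sum:
  assumes \<beta>: "\<And>q. q \<ge> 1 \<Longrightarrow> \<bar>\<beta> q\<bar> \<le> 1 / (4 * real g * real q ^ 2)"
  shows "(\<Sum>q\<in>{1..<g ^ K}. (\<Sum>a | 1 \<le> a \<and> a \<le> q \<and> coprime a q.
      norm (expsum (g ^ i) (real a / real q - \<beta> q))) / real q) \<le>
    C\<^sub>V * ((real g - 1) ^ i + real g ^ K * L ^ i)"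
proof -
  define T where "T = (\<lambda>q. \<Sum>a | 1 \<le> a \<and> a \<le> q \<and> coprime a q.
      norm (expsum (g ^ i) (real a / real q - \<beta> q)))"
  \<comment> \<open>The loss per digit when the trivial factor \<open>g - 1\<close> is replaced by
    the sum over all cells.\<close>
  define \<rho> where "\<rho> = real g * L / (real g - 1)"
  have \<rho>: "2 * \<rho> ^ 2 \<le> real g" "\<rho> \<ge> 0"
    using ratio g_ge L_ge by (auto simp: \<rho>_def L_def)
  have T0: "T q \<ge> 0" for q by (simp add: T_def sum_nonneg)
  have block: "(\<Sum>q\<in>{g ^ s..<g ^ Suc s}. T q / real q) \<le>
      (real g - 1) ^ i * \<rho> ^ 3 * (1 / 2) ^ s + real g ^ 3 * L ^ i * real g ^ s" for s
  proof -
    define m where "m = 2 * s + 3"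
    define S where "S = (\<Sum>(q, a)\<in>reduced_fractions s. norm (expsum (g ^ i) (real a / real q - \<beta> q)))"
    have "(\<Sum>q\<in>{g ^ s..<g ^ Suc s}. T q / real q) \<le> (\<Sum>q\<in>{g ^ s..<g ^ Suc s}. T q / real g ^ s)"
    proof (intro sum_mono)
      fix q assume "q \<in> {g ^ s..<g ^ Suc s}"
      hence "real g ^ s \<le> real q" by (simp flip: of_nat_power)
      moreover have "real g ^ s > 0" using g_ge by simp
      ultimately show "T q / real q \<le> T q / real g ^ s"
        using T0[of q] by (intro divide_left_mono mult_pos_pos) linarith+
    qed
    also have "\<dots> = S / real g ^ s"
      unfolding S_def reduced_fractions_def T_def
      by (subst sum.Sigma [symmetric]) (auto simp: sum_divide_distrib)
    also have "S \<le> (if m \<le> i then (real g - 1) ^ (i - m) * (real g * L) ^ m else real g ^ m * L ^ i)"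
      using sum_norm_expsum_separated[OF ln_base, of m "\<lambda>(q, a). real a / real q - \<beta> q"
          "reduced_fractions s" i] reduced_fractions_separated[OF \<beta>, of s]
      unfolding S_def L_def m_def by (simp add: case_prod_unfold)
    hence "S / real g ^ s \<le>
        (if m \<le> i then (real g - 1) ^ (i - m) * (real g * L) ^ m else real g ^ m * L ^ i) / real g ^ s"
      using g_ge by (intro divide_right_mono) auto
    also have "\<dots> \<le> (real g - 1) ^ i * \<rho> ^ 3 * (1 / 2) ^ s + real g ^ 3 * L ^ i * real g ^ s"
    proof (cases "m \<le> i")
      case True
      have "(real g - 1) ^ (i - m) * (real g * L) ^ m = (real g - 1) ^ i * \<rho> ^ m"
        using True g_ge by (simp add: \<rho>_def power_divide power_diff)
      also have "\<rho> ^ m = \<rho> ^ 3 * (\<rho> ^ 2) ^ s"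
        by (simp add: m_def power_add power_mult)
      finally have "(real g - 1) ^ (i - m) * (real g * L) ^ m / real g ^ s =
          (real g - 1) ^ i * \<rho> ^ 3 * (\<rho> ^ 2 / real g) ^ s"
        by (simp add: power_divide)
      also have "\<dots> \<le> (real g - 1) ^ i * \<rho> ^ 3 * (1 / 2) ^ s"
        using \<rho> g_ge by (intro mult_left_mono power_mono) (auto simp: field_simps)
      also have "\<dots> \<le> (real g - 1) ^ i * \<rho> ^ 3 * (1 / 2) ^ s + real g ^ 3 * L ^ i * real g ^ s"
        using L_ge by simp
      finally show ?thesis using True by simp
    next
      case False
      have "real g ^ m * L ^ i / real g ^ s = real g ^ 3 * L ^ i * real g ^ s"
        using g_ge by (simp add: m_def power_add power_mult power2_eq_square power_mult_distrib field_simps)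
      also have "\<dots> \<le> (real g - 1) ^ i * \<rho> ^ 3 * (1 / 2) ^ s + real g ^ 3 * L ^ i * real g ^ s"
        using g_ge \<rho> by simp
      finally show ?thesis using False by simp
    qed
    finally show ?thesis .
  qed
  have "(\<Sum>q\<in>{1..<g ^ K}. T q / real q) \<le>
      (\<Sum>s<K. (real g - 1) ^ i * \<rho> ^ 3 * (1 / 2) ^ s + real g ^ 3 * L ^ i * real g ^ s)"
    unfolding sum_power_blocks by (intro sum_mono block)
  also have "\<dots> = (real g - 1) ^ i * \<rho> ^ 3 * (\<Sum>s<K. (1 / 2) ^ s) + real g ^ 3 * L ^ i * (\<Sum>s<K. real g ^ s)"
    by (simp only: sum.distrib sum_distrib_left)
  also have "(\<Sum>s<K. (1 / 2) ^ s) \<le> (2 :: real)"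
    by (simp add: sum_gp_strict)
  hence "(real g - 1) ^ i * \<rho> ^ 3 * (\<Sum>s<K. (1 / 2) ^ s) \<le> (real g - 1) ^ i * \<rho> ^ 3 * 2"
    using g_ge \<rho> by (intro mult_left_mono) auto
  also have "(\<Sum>s<K. real g ^ s) \<le> real g ^ K"
    using g_ge by (intro sum_powers_less) auto
  hence "real g ^ 3 * L ^ i * (\<Sum>s<K. real g ^ s) \<le> real g ^ 3 * L ^ i * real g ^ K"
    using g_ge L_ge by (intro mult_left_mono) auto
  also have "(real g - 1) ^ i * \<rho> ^ 3 * 2 + real g ^ 3 * L ^ i * real g ^ K \<le>
      C\<^sub>V * ((real g - 1) ^ i + real g ^ K * L ^ i)"
    unfolding C\<^sub>V_def \<rho>_def [symmetric] using g_ge \<rho> L_ge by (simp add: algebra_simps)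
  finally show ?thesis by (simp add: T_def)
qed

end

section \<open>Divisor sums\<close>

lemma d2_le_small_divisors:
  assumes "n > 0"
  shows "d2 n \<le> 2 * card {d. d dvd n \<and> d * d \<le> n}"
proof -
  define S where "S = {d. d dvd n \<and> d * d \<le> n}"
  have fin: "finite S" using assms by (simp add: S_def)
  have "{d. d dvd n} \<subseteq> S \<union> (\<lambda>d. n div d) ` S"
  proof
    fix d assume "d \<in> {d. d dvd n}"
    then obtain c where c: "n = d * c" by auto
    have pos: "d > 0" "c > 0" using c assms by auto
    show "d \<in> S \<union> (\<lambda>d. n div d) ` S"
    proof (cases "d \<le> c")
      case True
      thus ?thesis using c by (auto simp: S_def)
    next
      case False
      hence "c \<in> S" using c by (auto simp: S_def)
      moreover have "d = n div c" using c pos by simp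
      ultimately show ?thesis by blast
    qed
  qed
  hence "d2 n \<le> card (S \<union> (\<lambda>d. n div d) ` S)"
    unfolding d2_def using fin by (intro card_mono) auto
  also have "\<dots> \<le> card S + card ((\<lambda>d. n div d) ` S)" by (rule card_Un_le)
  also have "\<dots> \<le> 2 * card S" using card_image_le[OF fin, of "\<lambda>d. n div d"] by simp
  finally show ?thesis by (simp add: S_def)
qed

text \<open>Orthogonality of additive characters: the terms are powers of a \<open>d\<close>-th root
  of unity, which is 1 if \<open>d\<close> divides \<open>n\<close>.\<close>

lemma divisor_indicator_le:
  assumes "d > 0"
  shows "(if d dvd n then real d else 0) \<le> Re (\<Sum>a=1..d. e (real n * (real a / real d)))"
proof -
  define z where "z = e (real n / real d)"
  have z: "(\<Sum>a=1..d. e (real n * (real a / real d))) = (\<Sum>a=1..d. z ^ a)"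
    by (simp add: z_def e_power mult.commute)
  have zd: "z ^ d = 1"
    using assms by (simp add: z_def e_power)
  show ?thesis
  proof (cases "z = 1")
    case True
    thus ?thesis unfolding z by simp
  next
    case False
    have "\<not> d dvd n"
    proof
      assume "d dvd n"
      then obtain c where "n = d * c" by auto
      hence "z = 1" using assms by (simp add: z_def)
      thus False using False by simp
    qed
    moreover have "(\<Sum>a=1..d. z ^ a) = z * (\<Sum>a<d. z ^ a)"
      by (simp add: sum_distrib_left sum.atLeast1_atMost_eq flip: power_Suc)
    hence "(\<Sum>a=1..d. z ^ a) = 0" using False zd by (simp add: sum_gp_strict)
    ultimately show ?thesis unfolding z by simp
  qed
qed

lemma card_multiples_le:
  assumes "finite S" "d > 0"
  shows "real (card {n \<in> S. d dvd n}) \<le> (\<Sum>a=1..d. norm (\<Sum>n\<in>S. e (real n * (real a / real d)))) / real d"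
proof -
  have "real d * real (card {n \<in> S. d dvd n}) = (\<Sum>n\<in>S. if d dvd n then real d else 0)"
    using assms(1) by (simp add: sum.If_cases Int_def mult.commute)
  also have "\<dots> \<le> (\<Sum>n\<in>S. Re (\<Sum>a=1..d. e (real n * (real a / real d))))"
    using assms(2) by (intro sum_mono divisor_indicator_le)
  also have "\<dots> = Re (\<Sum>a=1..d. \<Sum>n\<in>S. e (real n * (real a / real d)))"
    by (subst sum.swap) simp
  also have "\<dots> \<le> norm (\<Sum>a=1..d. \<Sum>n\<in>S. e (real n * (real a / real d)))"
    by (rule complex_Re_le_cmod)
  also have "\<dots> \<le> (\<Sum>a=1..d. norm (\<Sum>n\<in>S. e (real n * (real a / real d))))"
    by (rule norm_sum)
  finally show ?thesis using assms(2) by (simp add: field_simps)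
qed

text \<open>With \<open>c\<close> the gcd of \<open>a\<close> and \<open>d\<close>, write d = c q
  and a = c r. The weight 1/d splits as (1/c)(1/q), and summing over \<open>c\<close> produces the
  harmonic number, the logarithm lost for the divisor sum.\<close>

lemma sum_fractions_le_reduced:
  fixes h :: "real \<Rightarrow> real"
  assumes h: "\<And>x. h x \<ge> 0"
  shows "(\<Sum>d=1..D. (\<Sum>a=1..d. h (real a / real d)) / real d) \<le>
    harm D * (\<Sum>q=1..D. (\<Sum>a | 1 \<le> a \<and> a \<le> q \<and> coprime a q. h (real a / real q)) / real q)"
proof -
  define I where "I = (SIGMA d:{1..D}. {1..d})"
  define R where "R = (SIGMA q:{1..D}. {a. 1 \<le> a \<and> a \<le> q \<and> coprime a q})"
  define \<phi> where "\<phi> = (\<lambda>(d :: nat, a :: nat). (gcd a d, (d div gcd a d, a div gcd a d)))"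
  define t where "t = (\<lambda>(c, (q, a)). inverse (real c) * (h (real a / real q) / real q))"
  have finR: "finite R" unfolding R_def by (intro finite_SigmaI) auto
  have "(\<Sum>d=1..D. (\<Sum>a=1..d. h (real a / real d)) / real d) = (\<Sum>(d, a)\<in>I. h (real a / real d) / real d)"
    unfolding I_def by (subst sum.Sigma [symmetric]) (auto simp: sum_divide_distrib)
  also have "\<dots> = (\<Sum>x\<in>I. t (\<phi> x))"
  proof (intro sum.cong refl, clarify)
    fix d a assume "(d, a) \<in> I"
    hence da: "d > 0" "a > 0" by (auto simp: I_def)
    define c where "c = gcd a d"
    have c: "c > 0" using da by (simp add: c_def)
    obtain d' a' where d': "d = c * d'" "a = c * a'"
      unfolding c_def by (meson dvdE gcd_dvd1 gcd_dvd2)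
    show "h (real a / real d) / real d = t (\<phi> (d, a))"
      unfolding t_def \<phi>_def prod.case c_def [symmetric] using c by (simp add: d' field_simps)
  qed
  also have "\<dots> = sum t (\<phi> ` I)"
  proof (subst sum.reindex)
    show "inj_on \<phi> I"
    proof (rule inj_onI, clarify)
      fix d a d' a' assume "(d, a) \<in> I" "(d', a') \<in> I" and eq: "\<phi> (d, a) = \<phi> (d', a')"
      thus "d = d' \<and> a = a'"
        unfolding \<phi>_def prod.case by (metis dvd_mult_div_cancel gcd_dvd1 gcd_dvd2 prod.inject)
    qed
  qed simp
  \<comment> \<open>The image satisfies c q \<le> D; dropping this coupling makes the sum a
    product.\<close>
  also have "\<dots> \<le> sum t ({1..D} \<times> R)"
  proof (rule sum_mono2)
    show "finite ({1..D} \<times> R)" using finR by simp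
    show "\<phi> ` I \<subseteq> {1..D} \<times> R"
    proof
      fix x assume "x \<in> \<phi> ` I"
      then obtain d a where x: "x = \<phi> (d, a)" and da: "(d, a) \<in> I" by auto
      obtain c q r where eq: "\<phi> (d, a) = (c, q, r)" by (metis prod_cases3)
      from da have da': "1 \<le> d" "d \<le> D" "1 \<le> a" "a \<le> d" by (auto simp: I_def)
      have c: "c = gcd a d" and q: "q = d div c" and r: "r = a div c" using eq by (auto simp: \<phi>_def)
      have c0: "c > 0" using da' by (simp add: c)
      have dq: "d = c * q" "a = c * r" by (simp_all add: c q r)
      have "c \<le> D" using c da' by (metis gcd_le2_nat le_trans not_one_le_zero)
      moreover have "q \<le> D" using q da' by (meson div_le_dividend le_trans)
      moreover have "r \<le> q" unfolding q r by (rule div_le_mono) (fact da')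
      moreover have "q \<ge> 1" "r \<ge> 1" using dq da' by (metis One_nat_def Suc_leI mult_0_right neq0_conv not_one_le_zero)+
      moreover have "coprime r q"
        using div_gcd_coprime[of a d] da' by (simp add: c q r)
      ultimately show "x \<in> {1..D} \<times> R" using c0 x eq by (auto simp: R_def)
    qed
    show "t x \<ge> 0" for x using h by (auto simp: t_def case_prod_unfold)
  qed
  also have "\<dots> = (\<Sum>c=1..D. \<Sum>(q, a)\<in>R. inverse (real c) * (h (real a / real q) / real q))"
    unfolding sum.cartesian_product [symmetric] t_def by (simp add: case_prod_unfold)
  also have "\<dots> = harm D * (\<Sum>(q, a)\<in>R. h (real a / real q) / real q)"
    unfolding harm_def sum_product by (simp add: case_prod_unfold)
  also have "(\<Sum>(q, a)\<in>R. h (real a / real q) / real q) =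
      (\<Sum>q=1..D. (\<Sum>a | 1 \<le> a \<and> a \<le> q \<and> coprime a q. h (real a / real q)) / real q)"
    unfolding R_def by (subst sum.Sigma [symmetric]) (auto simp: sum_divide_distrib)
  finally show ?thesis .
qed

context large_base
begin

text \<open>The set is enlarged to a translate of all good numbers below \<open>g ^ J\<close>, whose
  exponential sum is a complete one up to a unimodular factor. Small divisors are then detected by
  characters, and the unshifted case of \<open>weighted_fraction_sum\<close> applies.\<close>

lemma divisor_sum_le:
  assumes "J \<le> k" and K: "K = (k + 2) div 2"
    and A: "A \<subseteq> (\<lambda>m. g ^ k + m) ` {m. m < g ^ J \<and> good m}"
  shows "(\<Sum>n\<in>A. real (d2 n)) \<le>
    2 * ((1 + ln (real g ^ K)) * (C\<^sub>V * ((real g - 1) ^ J + real g ^ K * L ^ J)))"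
proof -
  define S where "S = (\<lambda>m. g ^ k + m) ` {m. m < g ^ J \<and> good m}"
  define D where "D = g ^ K - 1"
  have g: "g \<ge> 2" using b_ge_2 b_less_g by simp
  have K0: "K > 0" using K by simp
  have gK: "g \<le> g ^ K" using self_le_power[of g K] g K0 by simp
  have D: "D > 0" "real D \<le> real g ^ K"
    using gK g by (simp_all add: D_def)
  have D_set: "{1..D} = {1..<g ^ K}" using gK g by (auto simp: D_def)
  have finS: "finite S" by (simp add: S_def)
  \<comment> \<open>Since \<open>2 * K \<ge> k + 1\<close> and n < 2 g^k, every divisor of
    \<open>n\<close> with square at most \<open>n\<close> is below \<open>g ^ K\<close>.\<close>
  have bound: "n > 0" "n < g ^ K * g ^ K" if n: "n \<in> S" for n
  proof -
    obtain m where m: "n = g ^ k + m" "m < g ^ J" using n by (auto simp: S_def)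
    show "n > 0" using m g by simp
    have "g ^ J \<le> g ^ k" using assms(1) g by (intro power_increasing) auto
    hence "n < 2 * g ^ k" using m by simp
    also have "\<dots> \<le> g ^ (k + 1)" using g by simp
    also have "\<dots> \<le> g ^ (K + K)" using g K by (intro power_increasing) auto
    finally show "n < g ^ K * g ^ K" by (simp add: power_add)
  qed
  have norm_S: "norm (\<Sum>n\<in>S. e (real n * x)) = norm (expsum (g ^ J) x)" for x
  proof -
    have "(\<Sum>n\<in>S. e (real n * x)) = (\<Sum>m | m < g ^ J \<and> good m. e (real (g ^ k) * x) * e (real m * x))"
      unfolding S_def by (subst sum.reindex) (auto simp: e_add [symmetric] algebra_simps intro: inj_onI)
    also have "\<dots> = e (real (g ^ k) * x) * expsum (g ^ J) x"
      by (simp add: expsum_def sum_distrib_left)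
    finally show ?thesis by (simp add: norm_mult)
  qed
  have "(\<Sum>n\<in>A. real (d2 n)) \<le> (\<Sum>n\<in>S. real (d2 n))"
    using A finS by (intro sum_mono2) (auto simp: S_def)
  also have "\<dots> \<le> (\<Sum>n\<in>S. 2 * (\<Sum>d=1..D. if d dvd n then 1 else 0))"
  proof (rule sum_mono)
    fix n assume n: "n \<in> S"
    have "{d. d dvd n \<and> d * d \<le> n} \<subseteq> {d\<in>{1..D}. d dvd n}"
    proof clarify
      fix d assume d: "d dvd n" "d * d \<le> n"
      have "d < g ^ K"
      proof (rule ccontr)
        assume "\<not> d < g ^ K"
        hence "g ^ K * g ^ K \<le> d * d" by (intro mult_mono) auto
        thus False using d bound[OF n] by simp
      qed
      moreover have "d > 0" using d bound[OF n] by (auto intro!: Nat.gr0I)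
      ultimately show "d \<in> {1..D}" unfolding D_set by simp
    qed
    hence "card {d. d dvd n \<and> d * d \<le> n} \<le> card {d\<in>{1..D}. d dvd n}" by (intro card_mono) auto
    hence "d2 n \<le> 2 * card {d\<in>{1..D}. d dvd n}"
      using d2_le_small_divisors[OF bound(1)[OF n]] by linarith
    hence "real (d2 n) \<le> 2 * real (card {d\<in>{1..D}. d dvd n})" by linarith
    also have "real (card {d\<in>{1..D}. d dvd n}) = (\<Sum>d=1..D. if d dvd n then 1 else 0)"
      by (simp add: sum.If_cases Int_def)
    finally show "real (d2 n) \<le> 2 * (\<Sum>d=1..D. if d dvd n then 1 else 0)" .
  qed
  also have "\<dots> = 2 * (\<Sum>d=1..D. real (card {n\<in>S. d dvd n}))"
    unfolding sum_distrib_left [symmetric] using finS by (subst sum.swap) (simp add: sum.If_cases Int_def)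
  also have "(\<Sum>d=1..D. real (card {n\<in>S. d dvd n})) \<le>
      (\<Sum>d=1..D. (\<Sum>a=1..d. norm (expsum (g ^ J) (real a / real d))) / real d)"
    using card_multiples_le[OF finS] unfolding norm_S by (intro sum_mono) auto
  also have "\<dots> \<le> harm D * (\<Sum>q=1..D. (\<Sum>a | 1 \<le> a \<and> a \<le> q \<and> coprime a q.
      norm (expsum (g ^ J) (real a / real q))) / real q)"
    by (rule sum_fractions_le_reduced) simp
  also have "\<dots> \<le> (1 + ln (real g ^ K)) * (C\<^sub>V * ((real g - 1) ^ J + real g ^ K * L ^ J))"
  proof (rule mult_mono)
    have "harm D \<le> 1 + ln (real D)" by (rule harm_le) (fact D)
    also have "ln (real D) \<le> ln (real g ^ K)" using D g by (subst ln_le_cancel_iff) auto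
    finally show "harm D \<le> 1 + ln (real g ^ K)" by simp
    show "0 \<le> 1 + ln (real g ^ K)" using g by (simp add: ln_realpow)
    show "(\<Sum>q=1..D. (\<Sum>a | 1 \<le> a \<and> a \<le> q \<and> coprime a q. norm (expsum (g ^ J) (real a / real q))) / real q)
        \<le> C\<^sub>V * ((real g - 1) ^ J + real g ^ K * L ^ J)"
      unfolding D_set using weighted_fraction_sum[of "\<lambda>_. 0" J K] by simp
    show "0 \<le> (\<Sum>q=1..D. (\<Sum>a | 1 \<le> a \<and> a \<le> q \<and> coprime a q. norm (expsum (g ^ J) (real a / real q))) / real q)"
      by (intro sum_nonneg divide_nonneg_nonneg) auto
  qed
  finally show ?thesis by (simp add: mult.assoc)
qed

end

section \<open>Major arcs\<close>

lemma e_has_vector_derivative: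
  "((\<lambda>x. e (\<beta> * x)) has_vector_derivative (2 * of_real pi * \<i> * of_real \<beta>) * e (\<beta> * x)) (at x within S)"
proof -
  define w where "w = 2 * of_real pi * \<i> * complex_of_real \<beta>"
  have e: "e (\<beta> * x) = exp (x *\<^sub>R w)" for x
    by (simp add: e_def w_def scaleR_conv_of_real algebra_simps)
  show ?thesis
    unfolding e w_def [symmetric] using exp_scaleR_has_vector_derivative_right[of w x S]
    by (simp add: mult.commute)
qed

lemma continuous_on_e [continuous_intros]:
  "continuous_on S f \<Longrightarrow> continuous_on S (\<lambda>x. e (f x))"
  unfolding e_def by (intro continuous_intros)

text \<open>The trivial bound and one integration by parts together bound the integral by M min(v -
  u, 1/|\<beta>|). The square root is a smooth form of this minimum whose antiderivative is
  \<open>arsinh\<close>.\<close>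

lemma norm_integral_log_e_le:
  fixes u v c \<beta> M :: real
  assumes uv: "0 < u" "u \<le> v" "v - u \<le> u" and M: "1 \<le> M" "\<And>x. x \<in> {u..v} \<Longrightarrow> \<bar>ln x + c\<bar> \<le> M"
  shows "norm (integral {u..v} (\<lambda>x. of_real (ln x + c) * e (\<beta> * x))) \<le>
    2 * M * (v - u) / sqrt (((v - u) * \<beta>) ^ 2 + 1)"
proof -
  define f where "f = (\<lambda>x. of_real (ln x + c) * e (\<beta> * x))"
  define y where "y = norm (integral {u..v} f)"
  have y0: "y \<ge> 0" by (simp add: y_def)
  have cont: "continuous_on {u..v} f"
    unfolding f_def using uv by (intro continuous_intros) auto
  have norm_f: "norm (f x) = \<bar>ln x + c\<bar>" for x
    unfolding f_def norm_mult norm_of_real by simp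
  have y1: "y \<le> M * (v - u)"
    unfolding y_def using uv M(2) by (intro integral_bound cont) (auto simp: norm_f)
  \<comment> \<open>The two boundary terms and the remaining integral are each at most M / |w|, the
    last by \<open>v - u \<le> u\<close> and \<open>1 \<le> M\<close>; and |w| = 2 pi |\<beta>| is
    at least 3 |\<beta>|.\<close>
  have y2: "y * \<bar>\<beta>\<bar> \<le> M"
  proof (cases "\<beta> = 0")
    case False
    define w where "w = 2 * of_real pi * \<i> * complex_of_real \<beta>"
    have w: "w \<noteq> 0" and norm_w: "norm w = 2 * pi * \<bar>\<beta>\<bar>" using False by (simp_all add: w_def norm_mult)
    define F where "F = (\<lambda>x. of_real (ln x + c) * e (\<beta> * x) / w)"
    define h where "h = (\<lambda>x. of_real (1 / x) * e (\<beta> * x) / w)"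
    have deriv: "(F has_vector_derivative (f x + h x)) (at x within {u..v})" if "x \<in> {u..v}" for x
    proof -
      have x: "x > 0" using that uv by simp
      have "((\<lambda>x. ln x + c) has_field_derivative 1 / x) (at x within {u..v})"
        using x by (auto intro!: derivative_eq_intros)
      hence "((\<lambda>x. complex_of_real (ln x + c)) has_vector_derivative of_real (1 / x)) (at x within {u..v})"
        by (rule has_vector_derivative_of_real)
      from has_vector_derivative_mult[OF this e_has_vector_derivative[of \<beta> x]]
      have "((\<lambda>x. of_real (ln x + c) * e (\<beta> * x)) has_vector_derivative
          (of_real (ln x + c) * (w * e (\<beta> * x)) + of_real (1 / x) * e (\<beta> * x))) (at x within {u..v})"
        by (simp only: w_def)
      from has_vector_derivative_divide[OF this, of w]
      show ?thesis unfolding F_def f_def h_def using w by (simp add: add_divide_distrib)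
    qed
    have "((\<lambda>x. f x + h x) has_integral (F v - F u)) {u..v}"
      by (rule fundamental_theorem_of_calculus) (use uv deriv in auto)
    moreover have conth: "continuous_on {u..v} h"
      unfolding h_def using uv w by (intro continuous_intros) auto
    ultimately have "integral {u..v} f + integral {u..v} h = F v - F u"
      using cont by (metis Henstock_Kurzweil_Integration.integral_add integrable_continuous_interval integral_unique)
    hence "integral {u..v} f = F v - F u - integral {u..v} h" by (simp add: algebra_simps)
    hence "y \<le> norm (F v) + norm (F u) + norm (integral {u..v} h)"
      unfolding y_def by (metis (no_types, opaque_lifting) norm_triangle_ineq4 norm_triangle_le_diff add_mono order_refl)
    also have "norm (F v) \<le> M / norm w"
      using M(2)[of v] uv norm_f[of v] unfolding F_def f_def norm_divide by (intro divide_right_mono) auto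
    also have "norm (F u) \<le> M / norm w"
      using M(2)[of u] uv norm_f[of u] unfolding F_def f_def norm_divide by (intro divide_right_mono) auto
    also have "norm (integral {u..v} h) \<le> (1 / u / norm w) * (v - u)"
    proof (intro integral_bound conth)
      fix x assume "x \<in> {u..v}"
      hence "1 / x \<le> 1 / u" "x > 0" using uv by (auto intro: divide_left_mono)
      thus "norm (h x) \<le> 1 / u / norm w"
        unfolding h_def norm_divide norm_mult norm_of_real by (intro divide_right_mono) auto
    qed (use uv in auto)
    also have "\<dots> = ((v - u) / u) / norm w" by simp
    also have "\<dots> \<le> M / norm w"
    proof (rule divide_right_mono)
      have "(v - u) / u \<le> 1" using uv by simp
      thus "(v - u) / u \<le> M" using M(1) by linarith
    qed simp
    finally have "y \<le> 3 * M / norm w" by (simp add: add_divide_distrib [symmetric])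
    hence "y * norm w \<le> 3 * M" using w by (simp add: field_simps)
    moreover have "y * (3 * \<bar>\<beta>\<bar>) \<le> y * norm w"
      unfolding norm_w using pi_approx y0 by (intro mult_left_mono mult_right_mono) auto
    ultimately show ?thesis by simp
  qed (use M in auto)
  define H where "H = v - u"
  have H: "H \<ge> 0" using uv by (simp add: H_def)
  have "y ^ 2 * ((H * \<beta>) ^ 2 + 1) \<le> (2 * M * H) ^ 2"
  proof -
    have "(y * \<bar>\<beta>\<bar>) ^ 2 \<le> M ^ 2" using y2 y0 by (intro power_mono) auto
    hence "(y * \<bar>\<beta>\<bar>) ^ 2 * H ^ 2 \<le> M ^ 2 * H ^ 2" by (intro mult_right_mono) auto
    moreover have "y ^ 2 \<le> (M * H) ^ 2" using y1 y0 by (intro power_mono) (auto simp: H_def)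
    moreover have "(2 * M * H) ^ 2 = 4 * (M ^ 2 * H ^ 2)" "(M * H) ^ 2 = M ^ 2 * H ^ 2"
      "y ^ 2 * ((H * \<beta>) ^ 2 + 1) = (y * \<bar>\<beta>\<bar>) ^ 2 * H ^ 2 + y ^ 2" "0 \<le> M ^ 2 * H ^ 2"
      by (simp_all add: power_mult_distrib algebra_simps)
    ultimately show ?thesis by linarith
  qed
  hence "sqrt (y ^ 2 * ((H * \<beta>) ^ 2 + 1)) \<le> sqrt ((2 * M * H) ^ 2)" by (rule real_sqrt_le_mono)
  hence "y * sqrt ((H * \<beta>) ^ 2 + 1) \<le> 2 * M * H"
    using y0 H M by (simp add: real_sqrt_mult)
  moreover have "sqrt ((H * \<beta>) ^ 2 + 1) > 0" by (simp add: add_nonneg_pos)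
  ultimately have "y \<le> 2 * M * H / sqrt ((H * \<beta>) ^ 2 + 1)" by (simp add: pos_le_divide_eq)
  thus ?thesis by (simp add: y_def f_def H_def)
qed

lemma arsinh_le_ln:
  assumes "(y::real) \<ge> 0"
  shows "arsinh y \<le> ln (2 * y + 1)"
proof -
  have "sqrt (y ^ 2 + 1) \<le> sqrt ((y + 1) ^ 2)"
    using assms by (intro real_sqrt_le_mono) (simp add: power2_eq_square algebra_simps)
  hence "y + sqrt (y ^ 2 + 1) \<le> 2 * y + 1" using assms by simp
  moreover have "y + sqrt (y ^ 2 + 1) > 0" using assms by (simp add: add_nonneg_pos)
  ultimately show ?thesis unfolding arsinh_real_def by (subst ln_le_cancel_iff) auto
qed

lemma norm_integral_le_arsinh:
  fixes f :: "real \<Rightarrow> complex"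
  assumes H: "H > 0" and \<delta>: "\<delta> > 0" and B: "B \<ge> 0"
    and f: "\<And>\<beta>. \<bar>\<beta>\<bar> < \<delta> \<Longrightarrow> norm (f \<beta>) \<le> B * (H / sqrt ((H * \<beta>) ^ 2 + 1))"
  shows "norm (integral {\<beta>. \<bar>\<beta>\<bar> < \<delta>} f) \<le> B * (2 * arsinh (H * \<delta>))"
proof -
  define G where "G = (\<lambda>\<beta>. B * (H / sqrt ((H * \<beta>) ^ 2 + 1)))"
  have set_eq: "{\<beta>. \<bar>\<beta>\<bar> < \<delta>} = box (-\<delta>) \<delta>" by (auto simp: box_real)
  have "((\<lambda>x. H / sqrt ((H * x) ^ 2 + 1)) has_integral (arsinh (H * \<delta>) - arsinh (H * - \<delta>))) {-\<delta>..\<delta>}"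
  proof (rule fundamental_theorem_of_calculus)
    fix x :: real
    have "((\<lambda>x. arsinh (H * x)) has_real_derivative (1 / sqrt ((H * x) ^ 2 + 1)) * H) (at x within {-\<delta>..\<delta>})"
      by (rule DERIV_chain2[OF arsinh_real_has_field_derivative]) (auto intro!: derivative_eq_intros)
    thus "((\<lambda>x. arsinh (H * x)) has_vector_derivative H / sqrt ((H * x) ^ 2 + 1)) (at x within {-\<delta>..\<delta>})"
      by (simp add: has_real_derivative_iff_has_vector_derivative)
  qed (use \<delta> in auto)
  hence "(G has_integral (B * (arsinh (H * \<delta>) - arsinh (H * - \<delta>)))) (cbox (-\<delta>) \<delta>)"
    unfolding G_def cbox_interval by (rule has_integral_mult_right)
  moreover have "arsinh (H * - \<delta>) = - arsinh (H * \<delta>)" using arsinh_minus_real[of "H * \<delta>"] by simp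
  ultimately have G: "(G has_integral (B * (2 * arsinh (H * \<delta>)))) {\<beta>. \<bar>\<beta>\<bar> < \<delta>}"
    unfolding set_eq has_integral_open_interval by simp
  have arsinh0: "arsinh (H * \<delta>) \<ge> 0"
  proof -
    have "1 \<le> sqrt ((H * \<delta>) ^ 2 + 1)" by simp
    moreover have "H * \<delta> > 0" using H \<delta> by simp
    ultimately show ?thesis unfolding arsinh_real_def by (intro ln_ge_zero) linarith
  qed
  show ?thesis
  proof (cases "f integrable_on {\<beta>. \<bar>\<beta>\<bar> < \<delta>}")
    case True
    have "norm (integral {\<beta>. \<bar>\<beta>\<bar> < \<delta>} f) \<le> integral {\<beta>. \<bar>\<beta>\<bar> < \<delta>} G"
      using True G f by (intro integral_norm_bound_integral) (auto simp: G_def)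
    thus ?thesis using G by (simp add: integral_unique)
  next
    case False
    \<comment> \<open>The integral of a non-integrable function is 0 by convention, so integrability
      in \<beta> need not be established.\<close>
    thus ?thesis using B arsinh0 by (simp add: not_integrable_integral)
  qed
qed

section \<open>Sums twisted by Ramanujan sums and their integrals over the major arcs\<close>

definition twisted_sum :: "nat set \<Rightarrow> nat \<Rightarrow> real \<Rightarrow> complex" where
  "twisted_sum A q \<beta> = (\<Sum>n\<in>A. ramanujan_sum q n * e (- (real n * \<beta>)))"

text \<open>Opening the Ramanujan sum turns the twist into exponential sums at the shifted reduced
  fractions.\<close>

lemma norm_twisted_sum_le:
  "norm (twisted_sum A q \<beta>) \<le>
    (\<Sum>a | 1 \<le> a \<and> a \<le> q \<and> coprime a q. norm (\<Sum>n\<in>A. e (real n * (real a / real q - \<beta>))))"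
proof -
  have "twisted_sum A q \<beta> =
      (\<Sum>n\<in>A. \<Sum>a | 1 \<le> a \<and> a \<le> q \<and> coprime a q. e (real n * (real a / real q - \<beta>)))"
    unfolding twisted_sum_def ramanujan_sum_def sum_distrib_right e_add [symmetric]
    by (simp add: algebra_simps)
  also have "\<dots> = (\<Sum>a | 1 \<le> a \<and> a \<le> q \<and> coprime a q. \<Sum>n\<in>A. e (real n * (real a / real q - \<beta>)))"
    by (rule sum.swap)
  finally show ?thesis by (simp add: norm_sum)
qed

text \<open>Continuity on a compact interval. One worst shift for each \<open>q\<close> then
  replaces the whole arc, which leaves a discrete sum over shifted fractions.\<close>

lemma twisted_sum_attains_sup:
  assumes "\<delta> \<ge> 0"
  obtains \<beta>' where "\<bar>\<beta>'\<bar> \<le> \<delta>" "\<And>\<beta>. \<bar>\<beta>\<bar> \<le> \<delta> \<Longrightarrow> norm (twisted_sum A q \<beta>) \<le> norm (twisted_sum A q \<beta>')"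
proof -
  have "continuous_on {-\<delta>..\<delta>} (\<lambda>\<beta>. norm (twisted_sum A q \<beta>))"
    unfolding twisted_sum_def by (intro continuous_intros)
  then obtain x where "x \<in> {-\<delta>..\<delta>}" "\<forall>y\<in>{-\<delta>..\<delta>}. norm (twisted_sum A q y) \<le> norm (twisted_sum A q x)"
    using continuous_attains_sup[of "{-\<delta>..\<delta>}" "\<lambda>\<beta>. norm (twisted_sum A q \<beta>)"] assms by auto
  thus ?thesis by (intro that[of x]) (auto simp: abs_le_iff)
qed

text \<open>The integrand is 1/q times an oscillatory integral times the twisted sum. The
  oscillatory integral costs 8 ln X, and integrating its decay over the arc gives at most 4 ln
  X.\<close>

lemma norm_major_arc_summand_le:
  fixes X H P Q W :: real
  assumes X: "X \<ge> 3" and H: "0 < H" "H \<le> X" and q: "1 \<le> q" "real q ^ 4 \<le> X" and Q: "Q \<ge> 1"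
    and W: "\<And>\<beta>. \<bar>\<beta>\<bar> \<le> 1 / (real q * Q) \<Longrightarrow> norm (twisted_sum A q \<beta>) \<le> W"
  shows "norm (integral {\<beta>. \<bar>\<beta>\<bar> < 1 / (real q * Q)} (\<lambda>\<beta>. integral {X..X + H} (\<lambda>x.
      of_real (p2_star q x) * e (\<beta> * x) * (\<Sum>n\<in>A. ramanujan_sum q n * e (- (real n * \<beta>))))))
    \<le> 32 * ln X ^ 2 * (W / real q)"
proof -
  define c where "c = 2 * euler_mascheroni - 2 * ln (real q)"
  define \<delta> where "\<delta> = 1 / (real q * Q)"
  define I where "I = (\<lambda>\<beta>. integral {X..X + H} (\<lambda>x. of_real (ln x + c) * e (\<beta> * x)))"
  have lnX: "ln X \<ge> 1"
    using X exp_le by (subst ln_ge_iff) auto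
  have \<delta>: "0 < \<delta>" "\<delta> \<le> 1"
  proof -
    have "1 * 1 \<le> real q * Q" using q Q by (intro mult_mono) auto
    thus "0 < \<delta>" "\<delta> \<le> 1" by (auto simp: \<delta>_def)
  qed
  have W0: "W \<ge> 0" using W[of 0] \<delta> by (smt (verit) \<delta>_def norm_ge_zero abs_zero)
  have inner: "integral {X..X + H} (\<lambda>x. of_real (p2_star q x) * e (\<beta> * x) *
      (\<Sum>n\<in>A. ramanujan_sum q n * e (- (real n * \<beta>)))) = of_real (1 / real q) * I \<beta> * twisted_sum A q \<beta>" for \<beta>
  proof -
    have "(\<lambda>x. of_real (p2_star q x) * e (\<beta> * x) * (\<Sum>n\<in>A. ramanujan_sum q n * e (- (real n * \<beta>)))) =
        (\<lambda>x. of_real (1 / real q) * (of_real (ln x + c) * e (\<beta> * x)) * twisted_sum A q \<beta>)"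
      unfolding p2_star_def c_def twisted_sum_def by (simp add: algebra_simps)
    thus ?thesis by (simp add: I_def)
  qed
  have I: "norm (I \<beta>) \<le> 2 * (4 * ln X) * H / sqrt ((H * \<beta>) ^ 2 + 1)" for \<beta>
  proof -
    have "norm (I \<beta>) \<le> 2 * (4 * ln X) * ((X + H) - X) / sqrt ((((X + H) - X) * \<beta>) ^ 2 + 1)"
      unfolding I_def
    proof (rule norm_integral_log_e_le)
      \<comment> \<open>Here ln x exceeds ln X by at most ln 2, the Euler constant is bounded, and
        q^4 \<le> X keeps 2 ln q below ln X.\<close>
      fix x assume x: "x \<in> {X..X + H}"
      have "ln x \<ge> ln X" using x X by simp
      moreover have "ln x \<le> ln (2 * X)" using x X H by (subst ln_le_cancel_iff) auto
      moreover have "ln (2 * X) = ln 2 + ln X" using X by (simp add: ln_mult)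
      moreover have "ln (real q ^ 4) \<le> ln X" using q X by (subst ln_le_cancel_iff) auto
      hence "4 * ln (real q) \<le> ln X" by (simp add: ln_realpow)
      moreover have "ln (real q) \<ge> 0" using q by simp
      moreover have "ln 2 \<le> (1 :: real)" using ln_le_minus_one[of "2 :: real"] by simp
      ultimately show "\<bar>ln x + c\<bar> \<le> 4 * ln X"
        unfolding c_def using euler_mascheroni_less_13_over_22 euler_mascheroni_pos lnX by linarith
    qed (use X H lnX in auto)
    thus ?thesis by simp
  qed
  have "norm (integral {\<beta>. \<bar>\<beta>\<bar> < \<delta>} (\<lambda>\<beta>. of_real (1 / real q) * I \<beta> * twisted_sum A q \<beta>))
      \<le> (8 * ln X * W / real q) * (2 * arsinh (H * \<delta>))"
  proof (rule norm_integral_le_arsinh)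
    fix \<beta> :: real assume \<beta>: "\<bar>\<beta>\<bar> < \<delta>"
    have "norm (of_real (1 / real q) * I \<beta> * twisted_sum A q \<beta>) = (1 / real q) * norm (I \<beta>) * norm (twisted_sum A q \<beta>)"
      by (simp add: norm_mult norm_divide)
    also have "\<dots> \<le> (1 / real q) * (2 * (4 * ln X) * H / sqrt ((H * \<beta>) ^ 2 + 1)) * W"
      using \<beta> W0 lnX H X by (intro mult_mono I W) (auto simp: \<delta>_def intro!: mult_nonneg_nonneg divide_nonneg_nonneg)
    finally show "norm (of_real (1 / real q) * I \<beta> * twisted_sum A q \<beta>) \<le>
        8 * ln X * W / real q * (H / sqrt ((H * \<beta>) ^ 2 + 1))"
      by (simp add: mult_ac)
  qed (use H \<delta> lnX W0 X in \<open>auto intro!: divide_nonneg_nonneg mult_nonneg_nonneg\<close>)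
  also have "\<dots> \<le> (8 * ln X * W / real q) * (2 * (2 * ln X))"
  proof (intro mult_left_mono)
    have "H * \<delta> \<le> X * 1" using H \<delta> by (intro mult_mono) auto
    hence "2 * (H * \<delta>) + 1 \<le> 3 * X" using X by simp
    also have "\<dots> \<le> X ^ 2" using X by (simp add: power2_eq_square)
    finally have le: "2 * (H * \<delta>) + 1 \<le> X ^ 2" .
    have "arsinh (H * \<delta>) \<le> ln (2 * (H * \<delta>) + 1)" using H \<delta> by (intro arsinh_le_ln) auto
    also have "\<dots> \<le> ln (X ^ 2)"
      using le H \<delta> X by (subst ln_le_cancel_iff) (auto intro: add_nonneg_pos)
    also have "\<dots> = 2 * ln X" using X by (simp add: ln_realpow)
    finally show "arsinh (H * \<delta>) \<le> 2 * ln X" by simp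
  qed (use lnX W0 X in \<open>auto intro!: divide_nonneg_nonneg mult_nonneg_nonneg\<close>)
  also have "\<dots> = 32 * ln X ^ 2 * (W / real q)" by (simp add: power2_eq_square)
  finally show ?thesis unfolding inner \<delta>_def .
qed

context large_base
begin

text \<open>Each arc is replaced by its worst shift and each incomplete sum by complete ones of
  lengths \<open>g ^ i\<close> with \<open>i \<le> J\<close>. After
  \<open>weighted_fraction_sum\<close> the powers in \<open>i\<close> sum to at most twice the last,
  turning 32 into 64.\<close>

lemma norm_major_arc_term_le:
  fixes X H P :: real
  assumes X: "X \<ge> 3" and H: "0 < H" "H \<le> X" and P: "4 * real g \<le> P" "P ^ 4 \<le> X"
    and K: "P < real g ^ K" and N: "N \<le> g ^ J"
    and A: "A = (\<lambda>m. r + m) ` {m. 0 < m \<and> m < N \<and> good m}"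
  shows "norm (major_arc_term A X H P (P ^ 2)) \<le>
    64 * (real g + 1) * C\<^sub>V * ln X ^ 2 * ((real g - 1) ^ J + real g ^ K * L ^ J)"
proof -
  have P1: "P \<ge> 1" using P g_ge by linarith
  \<comment> \<open>Passing to \<open>expsum N\<close> adds the term of 0; this costs 1, which the
    summand \<open>i = 0\<close> absorbs, hence the factor \<open>g + 1\<close>.\<close>
  have norm_A: "norm (\<Sum>n\<in>A. e (real n * x)) \<le> (real g + 1) * (\<Sum>i\<le>J. norm (expsum (g ^ i) x))" for x
  proof -
    have "(\<Sum>n\<in>A. e (real n * x)) =
        (\<Sum>m | 0 < m \<and> m < N \<and> good m. e (real r * x) * e (real m * x))"
      unfolding A by (subst sum.reindex) (auto simp: e_add [symmetric] algebra_simps intro: inj_onI)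
    also have "\<dots> = e (real r * x) * (\<Sum>m | 0 < m \<and> m < N \<and> good m. e (real m * x))"
      by (simp add: sum_distrib_left)
    also have "{m. 0 < m \<and> m < N \<and> good m} = {m. m < N \<and> good m} - {0}" by auto
    finally have "norm (\<Sum>n\<in>A. e (real n * x)) = norm (\<Sum>m\<in>{m. m < N \<and> good m} - {0}. e (real m * x))"
      by (simp add: norm_mult)
    also have "\<dots> \<le> norm (expsum N x) + 1"
      unfolding expsum_def using norm_triangle_ineq4[of "\<Sum>m | m < N \<and> good m. e (real m * x)" 1]
      by (auto simp: sum_diff1)
    also have "norm (expsum N x) \<le> real g * (\<Sum>i<Suc J. norm (expsum (g ^ i) x))"
    proof (rule norm_expsum_le)
      have "g ^ J < g ^ Suc J" using g_ge by simp
      thus "N < g ^ Suc J" using N by linarith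
    qed
    also have "1 \<le> (\<Sum>i\<le>J. norm (expsum (g ^ i) x))"
      using member_le_sum[of 0 "{..J}" "\<lambda>i. norm (expsum (g ^ i) x)"] by simp
    finally show ?thesis by (simp add: algebra_simps lessThan_Suc_atMost)
  qed
  have "\<exists>\<beta>'. \<bar>\<beta>'\<bar> \<le> 1 / (real q * P ^ 2) \<and> (\<forall>\<beta>. \<bar>\<beta>\<bar> \<le> 1 / (real q * P ^ 2) \<longrightarrow>
      norm (twisted_sum A q \<beta>) \<le> norm (twisted_sum A q \<beta>'))" for q
    using twisted_sum_attains_sup[of "1 / (real q * P ^ 2)" A q] P1 by (metis divide_nonneg_nonneg mult_nonneg_nonneg of_nat_0_le_iff zero_le_one zero_le_power2)
  then obtain \<beta> where \<beta>: "\<And>q. \<bar>\<beta> q\<bar> \<le> 1 / (real q * P ^ 2)"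
    "\<And>q \<theta>. \<bar>\<theta>\<bar> \<le> 1 / (real q * P ^ 2) \<Longrightarrow> norm (twisted_sum A q \<theta>) \<le> norm (twisted_sum A q (\<beta> q))"
    by metis
  \<comment> \<open>The shift condition must hold for every \<open>q \<ge> 1\<close>, but the arc
    radius ensures it only for \<open>q \<le> P\<close>, where 4 g q \<le> P^2; beyond that the
    shift is set to 0.\<close>
  define \<beta>' where "\<beta>' = (\<lambda>q. if real q \<le> P then \<beta> q else 0)"
  have \<beta>': "\<bar>\<beta>' q\<bar> \<le> 1 / (4 * real g * real q ^ 2)" if "q \<ge> 1" for q
  proof (cases "real q \<le> P")
    case True
    have "4 * real g * real q \<le> P * P" using P P1 True by (intro mult_mono) auto
    hence "real q * (4 * real g * real q) \<le> real q * P ^ 2"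
      unfolding power2_eq_square by (intro mult_left_mono) auto
    moreover have "0 < real q * (4 * real g * real q)" using that g_ge by simp
    ultimately have "1 / (real q * P ^ 2) \<le> 1 / (real q * (4 * real g * real q))"
      using that g_ge P1 by (intro divide_left_mono mult_pos_pos) auto
    also have "real q * (4 * real g * real q) = 4 * real g * real q ^ 2"
      by (simp add: power2_eq_square)
    finally show ?thesis using True \<beta>(1)[of q] by (simp add: \<beta>'_def)
  qed (auto simp: \<beta>'_def)
  define T where "T = (\<lambda>i q. (\<Sum>a | 1 \<le> a \<and> a \<le> q \<and> coprime a q.
      norm (expsum (g ^ i) (real a / real q - \<beta>' q))) / real q)"
  have T0: "T i q \<ge> 0" for i q by (simp add: T_def sum_nonneg)
  have "norm (major_arc_term A X H P (P ^ 2)) \<le>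
      (\<Sum>q | 1 \<le> q \<and> real q \<le> P. 32 * ln X ^ 2 * ((real g + 1) * (\<Sum>i\<le>J. T i q)))"
    unfolding major_arc_term_def
  proof (rule order.trans[OF norm_sum], rule sum_mono)
    fix q assume q: "q \<in> {q. 1 \<le> q \<and> real q \<le> P}"
    define W where "W = norm (twisted_sum A q (\<beta> q))"
    have q4: "real q ^ 4 \<le> X"
      using power_mono[of "real q" P 4] q P by (simp del: power_mono_iff)
    have "norm (integral {\<beta>. \<bar>\<beta>\<bar> < 1 / (real q * P ^ 2)} (\<lambda>\<beta>. integral {X..X + H} (\<lambda>x.
        of_real (p2_star q x) * e (\<beta> * x) * (\<Sum>n\<in>A. ramanujan_sum q n * e (- (real n * \<beta>))))))
      \<le> 32 * ln X ^ 2 * (W / real q)"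
      using X H q q4 P1 \<beta>(2) by (intro norm_major_arc_summand_le) (auto simp: W_def)
    also have "W \<le> (\<Sum>a | 1 \<le> a \<and> a \<le> q \<and> coprime a q.
        (real g + 1) * (\<Sum>i\<le>J. norm (expsum (g ^ i) (real a / real q - \<beta>' q))))"
      unfolding W_def using q by (intro order.trans[OF norm_twisted_sum_le] sum_mono) (auto simp: \<beta>'_def intro!: norm_A)
    also have "\<dots> = (real g + 1) * (\<Sum>i\<le>J. real q * T i q)"
      using q by (simp add: T_def sum_distrib_left [symmetric] sum.swap[of _ "{..J}"])
    finally show "norm (integral {\<beta>. \<bar>\<beta>\<bar> < 1 / (real q * P ^ 2)} (\<lambda>\<beta>. integral {X..X + H} (\<lambda>x.
        of_real (p2_star q x) * e (\<beta> * x) * (\<Sum>n\<in>A. ramanujan_sum q n * e (- (real n * \<beta>))))))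
      \<le> 32 * ln X ^ 2 * ((real g + 1) * (\<Sum>i\<le>J. T i q))"
      using q by (simp add: sum_distrib_left [symmetric] divide_right_mono mult_left_mono)
  qed
  also have "\<dots> = 32 * ln X ^ 2 * (real g + 1) * (\<Sum>q | 1 \<le> q \<and> real q \<le> P. \<Sum>i\<le>J. T i q)"
    by (simp add: sum_distrib_left mult.assoc)
  also have "\<dots> \<le> 32 * ln X ^ 2 * (real g + 1) * (\<Sum>q\<in>{1..<g ^ K}. \<Sum>i\<le>J. T i q)"
  proof (intro mult_left_mono)
    show "(\<Sum>q | 1 \<le> q \<and> real q \<le> P. \<Sum>i\<le>J. T i q) \<le> (\<Sum>q\<in>{1..<g ^ K}. \<Sum>i\<le>J. T i q)"
    proof (rule sum_mono2)
      show "{q. 1 \<le> q \<and> real q \<le> P} \<subseteq> {1..<g ^ K}"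
      proof clarify
        fix q assume q: "1 \<le> q" "real q \<le> P"
        have "real q < real g ^ K" using q K by linarith
        hence "q < g ^ K" by (metis of_nat_less_iff of_nat_power)
        thus "q \<in> {1..<g ^ K}" using q by simp
      qed
    qed (auto intro: sum_nonneg T0)
  qed auto
  also have "(\<Sum>q\<in>{1..<g ^ K}. \<Sum>i\<le>J. T i q) = (\<Sum>i\<le>J. \<Sum>q\<in>{1..<g ^ K}. T i q)" by (rule sum.swap)
  also have "32 * ln X ^ 2 * (real g + 1) * \<dots> \<le> 32 * ln X ^ 2 * (real g + 1) * (\<Sum>i\<le>J. C\<^sub>V * ((real g - 1) ^ i + real g ^ K * L ^ i))"
    unfolding T_def using \<beta>' by (intro mult_left_mono sum_mono weighted_fraction_sum) auto
  also have "(\<Sum>i\<le>J. C\<^sub>V * ((real g - 1) ^ i + real g ^ K * L ^ i)) = C\<^sub>V * ((\<Sum>i\<le>J. (real g - 1) ^ i) + real g ^ K * (\<Sum>i\<le>J. L ^ i))"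
    by (simp add: sum_distrib_left sum.distrib distrib_left)
  also have "32 * ln X ^ 2 * (real g + 1) * \<dots> \<le>
      32 * ln X ^ 2 * (real g + 1) * (C\<^sub>V * (2 * (real g - 1) ^ J + real g ^ K * (2 * L ^ J)))"
    using g_ge L_ge C\<^sub>V_nonneg by (intro mult_left_mono add_mono sum_powers_le) auto
  finally show ?thesis by (simp add: algebra_simps)
qed

end

section \<open>The error bound\<close>

lemma ln_ge_one: "(x::real) \<ge> 3 \<Longrightarrow> 1 \<le> ln x"
  using exp_le by (subst ln_ge_iff) auto

context large_base
begin

text \<open>The estimate for one fixed \<open>k\<close>, with the requirements that hold for all
  large \<open>X\<close> as hypotheses. The 6 comes from the divisor sum, the other summand of the
  first factor from the major arcs.\<close>

lemma error_bound:
  fixes H \<eta> :: real and k :: nat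
  defines "X \<equiv> real g ^ k"
  defines "T \<equiv> (X / (ln X) ^ 3) powr (1 / (2 * lambda_exp g))"
  defines "P \<equiv> X powr (1 / 4 - \<eta>)"
  defines "A \<equiv> missing_digit_interval g b X (X + H)"
  assumes X: "X \<ge> 3" and T: "T \<ge> 4" and Tk: "T + 3 < (real g - 1) ^ k"
    and \<eta>: "\<eta> > 0" and P: "4 * real g \<le> P" and lnX_le: "ln X powr (3 / 2) \<le> X powr (1 / 4)"
    and H: "H > 0" and card_H: "\<bar>real (card (missing_digit_interval g b 1 H)) - T\<bar> < 1"
  shows "norm ((\<Sum>n\<in>A. of_nat (d2 n)) - major_arc_term A X H P (P ^ 2)) \<le>
    (6 + 64 * (real g + 1)) * C\<^sub>V * (2 * (real g - 1) + 2 * real g * L) * real (card A) * ln X powr (5 / 2)"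
proof -
  define h where "h = nat \<lfloor>H\<rfloor>"
  define c where "c = card (missing_digit_interval g b 1 H)"
  define \<tau> where "\<tau> = lambda_exp g"
  define lX where "lX = ln X"
  have lX: "lX \<ge> 1" unfolding lX_def using X by (rule ln_ge_one)
  have k: "k \<ge> 1" using X unfolding X_def by (cases k) auto
  have le_H: "real n \<le> H \<longleftrightarrow> n \<le> h" for n
    unfolding h_def using H by (simp add: le_nat_iff le_floor_iff)
  have H_less: "H < real h + 1" unfolding h_def using H by linarith
  have c: "real c > T - 1" "real c < T + 1" using card_H unfolding c_def by linarith+
  have c_set: "missing_digit_interval g b 1 H = {n. 1 < n \<and> n \<le> h \<and> good n}"
    unfolding missing_digit_interval_def base_digits_iff_good by (auto simp: le_H)
  have "c > 0" using c T by linarith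
  hence h1: "h \<ge> 1" unfolding c_def c_set by (auto simp: card_gt_0_iff)
  obtain j where j: "g ^ j \<le> h" "h < g ^ (j + 1)"
    using ex_power_ivl1[of g h] g_ge h1 by auto
  define J where "J = j + 1"
  \<comment> \<open>The extra 2 accounts for 0 and 1, which the interval starting beyond 1
    omits.\<close>
  have card_j: "(real g - 1) ^ j \<le> real c + 2"
  proof -
    have "{m. m < g ^ j \<and> good m} \<subseteq> {0, 1} \<union> {n. 1 < n \<and> n \<le> h \<and> good n}"
      using j(1) by auto
    hence "card {m. m < g ^ j \<and> good m} \<le> card ({0, 1} \<union> {n. 1 < n \<and> n \<le> h \<and> good n})"
      by (intro card_mono) auto
    also have "\<dots> \<le> card {0, 1 :: nat} + c" unfolding c_def c_set by (rule card_Un_le)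
    finally have "(g - 1) ^ j \<le> c + 2" by (simp add: card_good_power)
    hence "real ((g - 1) ^ j) \<le> real (c + 2)" by (rule of_nat_mono)
    thus ?thesis using g_ge by (simp add: of_nat_diff)
  qed
  \<comment> \<open>The prescribed count is too small for \<open>H\<close> to reach
    \<open>X\<close>, so adding \<open>m \<le> h\<close> to \<open>X\<close> causes no
    carry.\<close>
  have "(real g - 1) ^ j < (real g - 1) ^ k" using card_j c(2) Tk by linarith
  hence "j < k" using g_ge by (simp add: power_strict_increasing_iff)
  hence Jk: "J \<le> k" by (simp add: J_def)
  have gJk: "g ^ J \<le> g ^ k" using Jk g_ge by (intro power_increasing) auto
  have hJ: "h < g ^ J" using j by (simp add: J_def)
  have "real h + 1 \<le> X"
  proof -
    have "h + 1 \<le> g ^ k" using hJ gJk by linarith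
    hence "real (h + 1) \<le> real (g ^ k)" by (rule of_nat_mono)
    thus ?thesis by (simp add: X_def)
  qed
  hence HX: "H \<le> X" using H_less by linarith
  \<comment> \<open>The leading digit of \<open>g ^ k + m\<close> is 1, which is allowed because
    \<open>b\<close> is at least 2.\<close>
  have good_shift: "good (g ^ k + m) \<longleftrightarrow> good m" if "m \<le> h" for m
    using good_add_iff[of m k 1] that hJ gJk g_ge b_ge_2 by auto
  have A: "A = (\<lambda>m. g ^ k + m) ` {m. 0 < m \<and> m < h + 1 \<and> good m}" (is "_ = ?B")
  proof (intro equalityI subsetI)
    fix n assume "n \<in> A"
    hence n: "X < real n" "real n \<le> X + H" "good n"
      by (auto simp: A_def missing_digit_interval_def base_digits_iff_good)
    have "real (g ^ k) < real n" using n by (simp add: X_def)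
    hence "g ^ k < n" by (simp only: of_nat_less_iff)
    then obtain m where m: "n = g ^ k + m" "m > 0" using less_imp_add_positive by blast
    have "real m \<le> H" using n m by (simp add: X_def)
    hence "m \<le> h" using le_H by simp
    thus "n \<in> ?B" using m n good_shift by auto
  next
    fix n assume "n \<in> ?B"
    then obtain m where m: "n = g ^ k + m" "m > 0" "m \<le> h" "good m" by auto
    thus "n \<in> A" using good_shift le_H[of m]
      by (auto simp: A_def missing_digit_interval_def base_digits_iff_good X_def)
  qed
  define a where "a = real (card A)"
  have "c \<le> card {m. 0 < m \<and> m < h + 1 \<and> good m}"
    unfolding c_def c_set by (intro card_mono) auto
  also have "\<dots> = card A" unfolding A by (subst card_image) (auto intro: inj_onI)
  finally have ca: "real c \<le> a" by (simp add: a_def)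
  \<comment> \<open>From \<open>T \<ge> 4\<close> one gets c > 3, which absorbs the rounding error
    and the additive 2 into factors 2.\<close>
  have a: "T \<le> 2 * a" "a > 0" "(real g - 1) ^ j \<le> 2 * a"
    using ca c T card_j by linarith+
  have gJ: "(real g - 1) ^ J \<le> 2 * (real g - 1) * a"
    using mult_left_mono[OF a(3), of "real g - 1"] g_ge by (simp add: J_def mult_ac)
  have \<tau>: "\<tau> \<ge> 2 / 3" using lambda by (simp add: \<tau>_def)
  have \<tau>1: "\<tau> \<le> 1"
    using g_ge L_ge unfolding \<tau>_def lambda_exp_def L_def [symmetric] by simp

  text \<open>This is where the exponent \<open>1 / (2 \<lambda>)\<close> in the size of \<open>[1, H]\<^sup>*\<close> is used:
    \<open>(g - 1) powr (1 - \<lambda>) = L\<close>.\<close>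

  have key: "sqrt X * L ^ J \<le> 2 * L * a * lX powr (3 / 2)"
  proof -
    have "(real g - 1) powr (1 - \<tau>) = L"
    proof -
      have "(1 - \<tau>) * ln (real g - 1) = ln L"
        using g_ge unfolding \<tau>_def lambda_exp_def L_def by simp
      thus ?thesis using g_ge L_ge by (simp add: powr_def)
    qed
    hence "L ^ j = ((real g - 1) powr (1 - \<tau>)) powr real j"
      using L_ge by (simp add: powr_realpow)
    also have "\<dots> = ((real g - 1) ^ j) powr (1 - \<tau>)"
      using g_ge by (simp add: powr_powr powr_realpow [symmetric] mult.commute)
    also have "\<dots> \<le> (2 * a) powr (1 - \<tau>)"
      using a(3) g_ge \<tau>1 by (intro powr_mono2) auto
    finally have Lj: "L ^ j \<le> (2 * a) powr (1 - \<tau>)" .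
    have "sqrt X = T powr \<tau> * lX powr (3 / 2)"
    proof -
      have "T powr \<tau> = (X / lX ^ 3) powr (1 / 2)"
        using \<tau> unfolding T_def \<tau>_def [symmetric] lX_def by (simp add: powr_powr)
      also have "\<dots> = X powr (1 / 2) / (lX ^ 3) powr (1 / 2)"
        using X lX by (simp add: powr_divide)
      also have "(lX ^ 3) powr (1 / 2) = (lX powr 3) powr (1 / 2)" using lX by simp
      also have "\<dots> = lX powr (3 / 2)" by (subst powr_powr) simp
      finally show ?thesis using lX X by (simp add: powr_half_sqrt)
    qed
    also have "\<dots> \<le> (2 * a) powr \<tau> * lX powr (3 / 2)"
      using a(1) T \<tau> by (intro mult_right_mono powr_mono2) auto
    \<comment> \<open>The exponents \<open>\<tau>\<close> and \<open>1 - \<tau>\<close> add up to 1,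
      which leaves exactly one factor |A|.\<close>
    finally have "sqrt X * L ^ j \<le> ((2 * a) powr \<tau> * lX powr (3 / 2)) * (2 * a) powr (1 - \<tau>)"
      using Lj L_ge by (intro mult_mono) auto
    also have "\<dots> = ((2 * a) powr \<tau> * (2 * a) powr (1 - \<tau>)) * lX powr (3 / 2)" by simp
    also have "(2 * a) powr \<tau> * (2 * a) powr (1 - \<tau>) = 2 * a"
      using a by (simp add: powr_add [symmetric])
    finally have "L * (sqrt X * L ^ j) \<le> L * (2 * a * lX powr (3 / 2))"
      using L_ge by (intro mult_left_mono) auto
    thus ?thesis by (simp add: J_def mult_ac)
  qed

  \<comment> \<open>The power 5/2 is 1 from the harmonic sum plus 3/2 from
    \<open>key\<close>.\<close>
  have divisors: "(\<Sum>n\<in>A. real (d2 n)) \<le>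
      6 * C\<^sub>V * (2 * (real g - 1) + 2 * real g * L) * a * lX powr (5 / 2)"
  proof -
    define K where "K = (k + 2) div 2"
    have gK: "real g ^ K \<le> real g * sqrt X"
    proof -
      have "(real g ^ K) ^ 2 = real g ^ (2 * K)" by (simp add: power_mult [symmetric] mult.commute)
      also have "\<dots> \<le> real g ^ (k + 2)" using g_ge by (intro power_increasing) (auto simp: K_def)
      also have "\<dots> = (real g * sqrt X) ^ 2"
        using X by (simp add: X_def power_add power_mult_distrib power2_eq_square)
      finally show ?thesis using g_ge X by (intro power2_le_imp_le[of "real g ^ K"]) auto
    qed
    have lnK: "1 + ln (real g ^ K) \<le> 3 * lX"
    proof -
      have "real K \<le> real (2 * k)" using k by (intro of_nat_mono) (auto simp: K_def)
      hence "real K * ln (real g) \<le> real (2 * k) * ln (real g)"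
        using ln_base by (intro mult_right_mono) auto
      moreover have "ln (real g ^ K) = real K * ln (real g)" "lX = real k * ln (real g)"
        using g_ge by (simp_all add: lX_def X_def ln_realpow)
      ultimately show ?thesis using lX by simp
    qed
    have sub: "A \<subseteq> (\<lambda>m. g ^ k + m) ` {m. m < g ^ J \<and> good m}"
      unfolding A using hJ by auto
    have "(\<Sum>n\<in>A. real (d2 n)) \<le>
        2 * ((1 + ln (real g ^ K)) * (C\<^sub>V * ((real g - 1) ^ J + real g ^ K * L ^ J)))"
      by (rule divisor_sum_le[OF Jk K_def sub])
    also have "\<dots> \<le> 2 * ((3 * lX) * (C\<^sub>V * (2 * (real g - 1) * a * lX powr (3 / 2)
        + real g * (2 * L * a * lX powr (3 / 2)))))"
    proof (intro mult_left_mono mult_mono[OF lnK] add_mono)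
      have "1 \<le> lX powr (3 / 2)" using lX by (simp add: ge_one_powr_ge_zero)
      hence "2 * (real g - 1) * a * 1 \<le> 2 * (real g - 1) * a * lX powr (3 / 2)"
        using g_ge a by (intro mult_left_mono) auto
      thus "(real g - 1) ^ J \<le> 2 * (real g - 1) * a * lX powr (3 / 2)" using gJ by linarith
      have "real g ^ K * L ^ J \<le> (real g * sqrt X) * L ^ J"
        using gK L_ge by (intro mult_right_mono) auto
      also have "\<dots> \<le> real g * (2 * L * a * lX powr (3 / 2))"
        using key by (simp add: mult.assoc mult_left_mono)
      finally show "real g ^ K * L ^ J \<le> real g * (2 * L * a * lX powr (3 / 2))" .
    qed (use C\<^sub>V_nonneg lX g_ge L_ge in \<open>auto intro!: mult_nonneg_nonneg add_nonneg_nonneg\<close>)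
    also have "\<dots> = 6 * C\<^sub>V * (2 * (real g - 1) + 2 * real g * L) * a * (lX * lX powr (3 / 2))"
      by (simp add: algebra_simps)
    also have "lX * lX powr (3 / 2) = lX powr (5 / 2)"
      using lX powr_add[of lX 1 "3 / 2"] by simp
    finally show ?thesis .
  qed

  have major: "norm (major_arc_term A X H P (P ^ 2)) \<le>
      64 * (real g + 1) * C\<^sub>V * (2 * (real g - 1) + 2 * real g * L) * a * lX powr (5 / 2)"
  proof -
    have P_le: "P \<le> X powr (1 / 4)"
      unfolding P_def using X \<eta> by (intro powr_mono) auto
    have P1: "P \<ge> 1" using P g_ge by linarith
    have "P ^ 4 \<le> (X powr (1 / 4)) ^ 4" using P_le P1 by (intro power_mono) auto
    also have "\<dots> = X"
      using X by (simp add: powr_power)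
    finally have P4: "P ^ 4 \<le> X" .
    have "nat \<lfloor>P\<rfloor> \<ge> 1" using P1 by (simp add: le_nat_iff)
    then obtain s where s: "g ^ s \<le> nat \<lfloor>P\<rfloor>" "nat \<lfloor>P\<rfloor> < g ^ (s + 1)"
      using ex_power_ivl1[of g "nat \<lfloor>P\<rfloor>"] g_ge by auto
    define K where "K = s + 1"
    have P_less: "P < real g ^ K"
    proof -
      have "real (nat \<lfloor>P\<rfloor> + 1) \<le> real (g ^ K)" using s(2) unfolding K_def by (intro of_nat_mono) simp
      thus ?thesis using P1 by simp linarith
    qed
    have gK: "real g ^ K \<le> real g * P"
    proof -
      have "real (g ^ s) \<le> real (nat \<lfloor>P\<rfloor>)" using s(1) by (rule of_nat_mono)
      also have "\<dots> \<le> P" using P1 by simp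
      finally show ?thesis by (simp add: K_def mult_left_mono)
    qed
    \<comment> \<open>Since \<open>P\<close> is at most X^(1/4), another X^(1/4) is available to
      cancel the logarithms of \<open>key\<close>.\<close>
    have PL: "P * L ^ J \<le> 2 * L * a"
    proof -
      have "P * lX powr (3 / 2) \<le> X powr (1 / 4) * X powr (1 / 4)"
        using P_le lnX_le unfolding lX_def by (intro mult_mono) auto
      also have "\<dots> = sqrt X" using X by (simp add: powr_add [symmetric] powr_half_sqrt)
      finally have "P * lX powr (3 / 2) * L ^ J \<le> sqrt X * L ^ J"
        using L_ge by (intro mult_right_mono) auto
      hence "(P * L ^ J) * lX powr (3 / 2) \<le> (2 * L * a) * lX powr (3 / 2)"
        using key by (simp add: mult_ac)
      thus ?thesis using lX by simp
    qed
    have gKL: "real g ^ K * L ^ J \<le> real g * (2 * L * a)"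
    proof -
      have "real g ^ K * L ^ J \<le> (real g * P) * L ^ J"
        using gK L_ge by (intro mult_right_mono) auto
      also have "\<dots> \<le> real g * (2 * L * a)"
        using PL by (simp add: mult.assoc mult_left_mono)
      finally show ?thesis .
    qed
    have l2: "lX ^ 2 \<le> lX powr (5 / 2)"
    proof -
      have "lX ^ 2 = lX powr 2" using lX by (simp add: powr_numeral)
      also have "\<dots> \<le> lX powr (5 / 2)" using lX by (intro powr_mono) auto
      finally show ?thesis .
    qed
    have "norm (major_arc_term A X H P (P ^ 2)) \<le>
        64 * (real g + 1) * C\<^sub>V * lX ^ 2 * ((real g - 1) ^ J + real g ^ K * L ^ J)"
      unfolding lX_def by (rule norm_major_arc_term_le[OF X H HX P P4 P_less _ A]) (use hJ in simp)
    also have "\<dots> \<le> 64 * (real g + 1) * C\<^sub>V * lX powr (5 / 2) * (2 * (real g - 1) * a + real g * (2 * L * a))"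
      by (rule mult_mono[OF mult_left_mono[OF l2] add_mono[OF gJ gKL]])
         (use C\<^sub>V_nonneg lX g_ge L_ge in \<open>auto intro!: mult_nonneg_nonneg add_nonneg_nonneg\<close>)
    also have "\<dots> = 64 * (real g + 1) * C\<^sub>V * (2 * (real g - 1) + 2 * real g * L) * a * lX powr (5 / 2)"
      by (simp add: algebra_simps)
    finally show ?thesis .
  qed

  have "norm ((\<Sum>n\<in>A. of_nat (d2 n)) - major_arc_term A X H P (P ^ 2)) \<le>
      norm (\<Sum>n\<in>A. complex_of_nat (d2 n)) + norm (major_arc_term A X H P (P ^ 2))"
    by (rule norm_triangle_ineq4)
  also have "norm (\<Sum>n\<in>A. complex_of_nat (d2 n)) \<le> (\<Sum>n\<in>A. real (d2 n))"
    by (rule order.trans[OF norm_sum]) simp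
  also note divisors
  also note major
  finally show ?thesis by (simp add: a_def lX_def algebra_simps)
qed

text \<open>The left power is at most X^(3/4) because 1/(2 lambda) is at most 3/4. On the other side
  \<open>g - 1\<close> is at least 2 g^(3/4), and the surplus factor 2^k \<ge> 8 absorbs the
  3.\<close>

lemma size_less_power:
  assumes "k \<ge> 3"
  defines "X \<equiv> real g ^ k"
  shows "(X / (ln X) ^ 3) powr (1 / (2 * lambda_exp g)) + 3 < (real g - 1) ^ k"
proof -
  have g0: "real g > 0" using g_ge by simp
  have gX: "real g ^ 1 \<le> X" unfolding X_def using g_ge assms by (intro power_increasing) auto
  hence X: "X \<ge> 9" using g_ge by simp
  have lnX: "ln X \<ge> 1" using X by (intro ln_ge_one) auto
  have "(X / (ln X) ^ 3) powr (1 / (2 * lambda_exp g)) \<le> X powr (1 / (2 * lambda_exp g))"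
  proof (rule powr_mono2)
    show "X / (ln X) ^ 3 \<le> X" using X lnX by (simp add: divide_le_eq mult_le_cancel_left1)
  qed (use X lnX lambda in auto)
  also have "\<dots> \<le> X powr (3 / 4)"
    using X lambda by (intro powr_mono) (auto simp: field_simps)
  finally have 1: "(X / (ln X) ^ 3) powr (1 / (2 * lambda_exp g)) \<le> X powr (3 / 4)" .
  have "real g powr (1 / 4) \<ge> 4"
  proof -
    have "exp 1 * exp 1 \<ge> 2 * (2 :: real)"
      using exp_ge_add_one_self[of "1 :: real"] by (intro mult_mono) auto
    also have "exp 1 * exp (1 :: real) = exp 2" by (simp add: exp_add [symmetric])
    also have "exp 2 \<le> exp (1 / 4 * ln (real g))" using ln_base by simp
    also have "\<dots> = real g powr (1 / 4)" using g0 by (simp add: powr_def)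
    finally show ?thesis by simp
  qed
  hence "4 * real g powr (3 / 4) \<le> real g powr (1 / 4) * real g powr (3 / 4)"
    by (intro mult_right_mono) auto
  also have "\<dots> = real g" using g0 by (simp add: powr_add [symmetric])
  finally have "2 * real g powr (3 / 4) \<le> real g - 1" using g_ge by simp
  hence "(2 * real g powr (3 / 4)) ^ k \<le> (real g - 1) ^ k" by (intro power_mono) auto
  moreover have "(2 * real g powr (3 / 4)) ^ k = 2 ^ k * X powr (3 / 4)"
    using g0 by (simp add: power_mult_distrib X_def powr_realpow [symmetric] powr_powr mult.commute)
  moreover have "(2 :: real) ^ 3 \<le> 2 ^ k" using assms by (intro power_increasing) auto
  hence "8 * X powr (3 / 4) \<le> 2 ^ k * X powr (3 / 4)" by (intro mult_right_mono) auto
  moreover have "X powr (3 / 4) \<ge> 1" using X by (intro ge_one_powr_ge_zero) auto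
  ultimately show ?thesis using 1 by linarith
qed

end

text \<open>The conditions of \<open>large_base\<close> hold for all large \<open>g\<close> and
  those of \<open>error_bound\<close> for all large \<open>k\<close>; the constant obtained depends
  on \<open>g\<close> alone.\<close>

theorem theorem1p1:
  shows "\<exists>(g\<^sub>0::nat) (\<eta>\<^sub>0::real). \<eta>\<^sub>0 > 0 \<and>
    (\<forall>g\<ge>g\<^sub>0. \<forall>b\<in>{2..g - 1}. \<forall>\<eta>. 0 < \<eta> \<and> \<eta> < \<eta>\<^sub>0 \<longrightarrow>
      (\<exists>C::real. \<forall>\<^sub>F k::nat in at_top. \<forall>H::real.
        let X = real g ^ k;
            P = X powr (1 / 4 - \<eta>);
            Q = P ^ 2;
            A = missing_digit_interval g b X (X + H)
        in H > 0 \<and>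
           \<bar>real (card (missing_digit_interval g b 1 H))
             - (X / (ln X) ^ 3) powr (1 / (2 * lambda_exp g))\<bar> < 1
           \<longrightarrow> norm ((\<Sum>n\<in>A. of_nat (d2 n)) - major_arc_term A X H P Q)
                 \<le> C * real (card A) * (ln X) powr (5 / 2)))"
proof -
  have "\<forall>\<^sub>F g::nat in at_top. 8 \<le> ln (real g)" by real_asymp
  moreover have "\<forall>\<^sub>F g::nat in at_top. 2 * (real g * (ln (real g) + 1) / (real g - 1)) ^ 2 \<le> real g"
    by real_asymp
  moreover have "\<forall>\<^sub>F g::nat in at_top. 2 / 3 \<le> lambda_exp g"
    unfolding lambda_exp_def by real_asymp
  ultimately have "\<forall>\<^sub>F g::nat in at_top. 8 \<le> ln (real g) \<and>
      2 * (real g * (ln (real g) + 1) / (real g - 1)) ^ 2 \<le> real g \<and> 2 / 3 \<le> lambda_exp g"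
    by eventually_elim auto
  then obtain g\<^sub>0 where g\<^sub>0: "\<And>g. g \<ge> g\<^sub>0 \<Longrightarrow> 8 \<le> ln (real g) \<and>
      2 * (real g * (ln (real g) + 1) / (real g - 1)) ^ 2 \<le> real g \<and> 2 / 3 \<le> lambda_exp g"
    by (auto simp: eventually_at_top_linorder)
  show ?thesis
  \<comment> \<open>With 1/4 as the bound for \<open>\<eta>\<close> the exponent
    \<open>1 / 4 - \<eta>\<close> is positive, so \<open>P\<close> eventually exceeds
    \<open>4 * real g\<close>.\<close>
  proof (rule exI[of _ g\<^sub>0], rule exI[of _ "1 / 4"], intro conjI allI ballI impI)
    fix g b :: nat and \<eta> :: real
    assume g: "g \<ge> g\<^sub>0" and b: "b \<in> {2..g - 1}" and \<eta>: "0 < \<eta> \<and> \<eta> < 1 / 4"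
    interpret large_base g b
      by unfold_locales (use b g\<^sub>0[OF g] in auto)
    define X where "X = (\<lambda>k::nat. real g ^ k)"
    define \<kappa> where "\<kappa> = 1 / (2 * lambda_exp g)"
    have \<kappa>: "\<kappa> > 0" using lambda by (simp add: \<kappa>_def)
    have \<mu>: "1 / 4 - \<eta> > 0" using \<eta> by simp
    have X: "filterlim X at_top sequentially"
    proof -
      have "1 < real g" using g_ge by simp
      thus ?thesis unfolding X_def by real_asymp
    qed
    have "\<forall>\<^sub>F x::real in at_top. x \<ge> 3" by real_asymp
    hence 1: "\<forall>\<^sub>F k in sequentially. X k \<ge> 3" by (rule eventually_compose_filterlim) (fact X)
    have "\<forall>\<^sub>F x::real in at_top. (x / (ln x) ^ 3) powr \<kappa> \<ge> 4" using \<kappa> by real_asymp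
    hence 2: "\<forall>\<^sub>F k in sequentially. (X k / (ln (X k)) ^ 3) powr \<kappa> \<ge> 4"
      by (rule eventually_compose_filterlim) (fact X)
    have "\<forall>\<^sub>F x::real in at_top. 4 * real g \<le> x powr (1 / 4 - \<eta>)" using \<mu> by real_asymp
    hence 3: "\<forall>\<^sub>F k in sequentially. 4 * real g \<le> X k powr (1 / 4 - \<eta>)"
      by (rule eventually_compose_filterlim) (fact X)
    have "\<forall>\<^sub>F x::real in at_top. ln x powr (3 / 2) \<le> x powr (1 / 4)" by real_asymp
    hence 4: "\<forall>\<^sub>F k in sequentially. ln (X k) powr (3 / 2) \<le> X k powr (1 / 4)"
      by (rule eventually_compose_filterlim) (fact X)
    have 5: "\<forall>\<^sub>F k::nat in sequentially. k \<ge> 3" by (rule eventually_ge_at_top)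
    show "\<exists>C::real. \<forall>\<^sub>F k::nat in at_top. \<forall>H::real.
        let X = real g ^ k;
            P = X powr (1 / 4 - \<eta>);
            Q = P ^ 2;
            A = missing_digit_interval g b X (X + H)
        in H > 0 \<and>
           \<bar>real (card (missing_digit_interval g b 1 H))
             - (X / (ln X) ^ 3) powr (1 / (2 * lambda_exp g))\<bar> < 1
           \<longrightarrow> norm ((\<Sum>n\<in>A. of_nat (d2 n)) - major_arc_term A X H P Q)
                 \<le> C * real (card A) * (ln X) powr (5 / 2)" (is "\<exists>C. \<forall>\<^sub>F k in _. ?bound C k")
    proof -
      define C where "C = (6 + 64 * (real g + 1)) * C\<^sub>V * (2 * (real g - 1) + 2 * real g * L)"
      have "\<forall>\<^sub>F k in at_top. ?bound C k"
        using 1 2 3 4 5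
      proof eventually_elim
        case (elim k)
        show ?case
          unfolding Let_def C_def using elim \<eta> size_less_power[of k]
          by (intro allI impI error_bound) (auto simp: X_def \<kappa>_def)
      qed
      thus ?thesis by blast
    qed
  qed auto
qed

end
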